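(* Let $p\ge 1$, let $\mathcal M$ be a Riemannian manifold with retraction $R$ and vector transport $\mathrm{VT}$, and let $f\in C^p(\mathcal M)$ be bounded below with $f^*=\inf_{\mathcal M} f$. Run $p$-RAR (first-order mode) with tolerance $\epsilon_1>0$, and let $\{v_i\}$ be the set of increments it generates. Suppose that, for some $L>0$ and $r,b>0$, on the set $\{v_i\}$ the function $f$ is $(L,p,R)$-majorization smooth and $(L,p,R,\mathrm{VT})$-smooth, and $\mathrm{VT}$ satisfies an $(r,b)$-short-step lower bound. Then $p$-RAR finds an $\epsilon_1$-stationary point (a point $x$ with $\|\operatorname{grad} f(x)\|_x\le\epsilon_1$) in at most $$\mathcal O\left[\left(\frac{L}{\epsilon_1}\right)^{\frac{p+1}{p}}\right]$$ total iterations and calls to the derivative oracles $\{x\mapsto D^k\hat f_x(0)\}_{k=0}^p$. Here the $\mathcal O$ means: for all $L_0,\epsilon_0>0$ there is a constant $C$ depending only on $p$, the algorithm parameters $\theta,\eta_1,\eta_2,\gamma_1,\gamma_2,\gamma_3,\alpha_{\min},\alpha_0$, the constants $r,b$, the gap $f(x_0)-f^*$, and $L_0,\epsilon_0$, such that the count is at most $C(L/\epsilon_1)^{(p+1)/p}$ whenever $L\ge L_0$ and $0<\epsilon_1\le\epsilon_0$.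
   Context: Notation. $\pi:\mathcal T\mathcal M\to\mathcal M$ is the tangent bundle projection; $\|\cdot\|_x$ is the Riemannian norm on $\mathcal T_x\mathcal M$; $\|\cdot\|_{op}$ is the operator norm of multilinear maps (supremum over unit arguments). A retraction is a smooth map $R:\mathcal T\mathcal M\to\mathcal M$ with $R(0_x)=x$ and $d(R|_{\mathcal T_x\mathcal M})_{0_x}=\mathrm{Id}$ for all $x$. The pullback is $\hat f_x:=f\circ R|_{\mathcal T_x\mathcal M}$, and $D^j\hat f_x$ is its classical $j$-th derivative on the vector space $\mathcal T_x\mathcal M$. Put $T_p\hat f_x(0,v)=\sum_{j=0}^p\frac1{j!}D^j\hat f_x(0)[v^{\otimes j}]$, let $T_{p-1}D\hat f_x(0,v)$ be the $(p-1)$-th order Taylor expansion of $D\hat f_x$ at $0$ evaluated at $v$, and $m_p(\alpha,x;v)=T_p\hat f_x(0,v)+\frac{\alpha}{p+1}\|v\|_x^{p+1}$. A vector transport $\mathrm{VT}$ is a smooth map assigning to each $u\in\mathcal T\mathcal M$ a linear map $\mathrm{VT}_u:\mathcal T_{\pi(u)}\mathcal M\to\mathcal T_{R(u)}\mathcal M$ with $\mathrm{VT}_{0_x}=\mathrm{Id}$. For a covariant $\ell$-tensor $T$ at $R(w)$, $(\mathrm{VT}_w)^*T(v_1,\dots,v_\ell)=T(\mathrm{VT}_wv_1,\dots,\mathrm{VT}_wv_\ell)$. Assumptions on a set $S\subseteq\mathcal T\mathcal M$: - $f$ is $(L,p,R)$-majorization smooth on $S$ if $\hat f_{\pi(v)}(v)\le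 T_p\hat f_{\pi(v)}(0,v)+\frac{L}{p+1}\|v\|^{p+1}$ for all $v\in S$. - $f$ is $(L,p,R,\mathrm{VT})$-smooth on $S$ if $\|(\mathrm{VT}_v)^*D\hat f_{R(v)}(0)-T_{p-1}D\hat f_{\pi(v)}(0,v)\|_{op}\le\frac{p}{p+1}L\|v\|^p$ for all $v\in S$. - $\mathrm{VT}$ satisfies an $(r,b)$-short-step lower bound on $S$ if $\inf_{v\in S,\ \|v\|\le r}\sigma_{\min}(\mathrm{VT}_v)\ge b$, where $\sigma_{\min}$ is the smallest singular value. Algorithm $p$-RAR (first-order mode). Inputs: $x_0\in\mathcal M$, $\epsilon_1>0$, $\theta>0$, $0<\alpha_{\min}\le\alpha_0$, $0<\eta_1\le\eta_2<1$, $0<\gamma_1<1<\gamma_2<\gamma_3$. For $i=0,1,2,\dots$: stop and return $x_i$ if $\|\operatorname{grad}f(x_i)\|_{x_i}\le\epsilon_1$. Otherwise select any $v_i\in\mathcal T_{x_i}\mathcal M$ with $m_p(\alpha_i,x_i;v_i)\le m_p(\alpha_i,x_i;0)$ and $\|Dm_p(\alpha_i,x_i;v_i)\|_{op}\le\theta\|v_i\|_{x_i}^p$ (derivative in the tangent-vector variable). Compute $\rho_i=\frac{f(x_i)-f(R(v_i))}{f(x_i)-T_p\hat f_{x_i}(0,v_i)}$. Set $x_{i+1}=R(v_i)$ if $\rho_i\ge\eta_1$ and $x_{i+1}=x_i$ otherwise. Choose $\alpha_{i+1}\in[\max\{\alpha_{\min},\gamma_1\alpha_i\},\alpha_i]$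 if $\rho_i\ge\eta_2$; $\alpha_{i+1}\in[\alpha_i,\gamma_2\alpha_i]$ if $\eta_1\le\rho_i<\eta_2$; $\alpha_{i+1}\in[\gamma_2\alpha_i,\gamma_3\alpha_i]$ if $\rho_i<\eta_1$. *)

theory Defs
  imports "HOL-Analysis.Analysis" "HOL-Library.Extended_Nat"
begin

section \<open>Higher derivatives and Taylor polynomials\<close>

(* For f of class C^j, hderiv f [v1, ..., vj] x = D^j f(x)[v1, ..., vj]. *)
primrec hderiv ::
  "('a::real_normed_vector \<Rightarrow> 'b::real_normed_vector) \<Rightarrow> 'a list \<Rightarrow> 'a \<Rightarrow> 'b" where
  "hderiv f [] = f"
| "hderiv f (v # vs) = (\<lambda>x. frechet_derivative (hderiv f vs) (at x) v)"

(* Class C^k on an open set S.  In finite dimension, continuity of x \<mapsto> Df(x) is the same as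
   continuity of x \<mapsto> Df(x)[v] for each v, so the recursion can evaluate Df at fixed vectors. *)
primrec Ck_on ::
  "nat \<Rightarrow> 'a::euclidean_space set \<Rightarrow> ('a \<Rightarrow> 'b::real_normed_vector) \<Rightarrow> bool" where
  "Ck_on 0 S f \<longleftrightarrow> continuous_on S f"
| "Ck_on (Suc k) S f \<longleftrightarrow>
     (\<forall>x\<in>S. f differentiable (at x)) \<and> (\<forall>v. Ck_on k S (\<lambda>x. frechet_derivative f (at x) v))"

definition smooth_on ::
  "'a::euclidean_space set \<Rightarrow> ('a \<Rightarrow> 'b::real_normed_vector) \<Rightarrow> bool" where
  "smooth_on S f \<longleftrightarrow> (\<forall>k. Ck_on k S f)"

definition taylor ::
  "nat \<Rightarrow> ('a::real_normed_vector \<Rightarrow> 'b::real_normed_vector) \<Rightarrow> 'a \<Rightarrow> 'b" where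
  "taylor n f v = (\<Sum>j\<le>n. (1 / fact j) *\<^sub>R hderiv f (replicate j v) 0)"


section \<open>Smooth manifolds, tangent bundle, Riemannian metrics\<close>

(* A chart is a pair (domain, coordinate map). *)
type_synonym ('m, 'e) chart = "'m set \<times> ('m \<Rightarrow> 'e)"

abbreviation chart_image :: "('m, 'e) chart \<Rightarrow> 'e set" where
  "chart_image c \<equiv> snd c ` fst c"

definition chart_inv :: "('m, 'e) chart \<Rightarrow> 'e \<Rightarrow> 'm" where
  "chart_inv c = inv_into (fst c) (snd c)"

definition smooth_atlas ::
  "('m::{t2_space,second_countable_topology}, 'e::euclidean_space) chart set \<Rightarrow> bool" where
  "smooth_atlas A \<longleftrightarrow>
     (\<Union>c\<in>A. fst c) = UNIV \<and>
     (\<forall>c\<in>A. open (fst c) \<and> open (chart_image c) \<and>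
            homeomorphism (fst c) (chart_image c) (snd c) (chart_inv c)) \<and>
     (\<forall>c\<in>A. \<forall>d\<in>A. smooth_on (snd c ` (fst c \<inter> fst d)) (snd d \<circ> chart_inv c))"

definition Ck_fun :: "nat \<Rightarrow> ('m, 'e::euclidean_space) chart set \<Rightarrow> ('m \<Rightarrow> real) \<Rightarrow> bool" where
  "Ck_fun k A F \<longleftrightarrow> (\<forall>c\<in>A. Ck_on k (chart_image c) (F \<circ> chart_inv c))"

(* Smoothness between manifolds given by atlases.  Openness of the coordinate domains, together
   with smoothness of the coordinate expressions, includes continuity for the topologies defined
   by the two atlases; no topology on the point types is used. *)
definition smooth_map ::
  "('p, 'a::euclidean_space) chart set \<Rightarrow> ('q, 'b::euclidean_space) chart set \<Rightarrow> ('p \<Rightarrow> 'q) \<Rightarrow> bool"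
  where
  "smooth_map A B F \<longleftrightarrow>
     (\<forall>a\<in>A. \<forall>b\<in>B.
        let D = {y \<in> chart_image a. F (chart_inv a y) \<in> fst b}
        in open D \<and> smooth_on D (snd b \<circ> F \<circ> chart_inv a))"

definition chart_at :: "('m, 'e) chart set \<Rightarrow> 'm \<Rightarrow> ('m, 'e) chart" where
  "chart_at A x = (SOME c. c \<in> A \<and> x \<in> fst c)"

(* The tangent space at x is identified with the model space 'e by means of the chart
   chart_at A x, so a tangent vector is a pair (x, v) :: 'm \<times> 'e and 0_x is (x, 0).
   tangent_coord A c x v is the coordinate vector of (x, v) in another chart c around x.
   The bundle topology and smooth structure on 'm \<times> 'e are those of tangent_atlas below, not the
   product structure, since chart_at A x jumps with x. *)
definition tangent_coord ::
  "('m, 'e::euclidean_space) chart set \<Rightarrow> ('m, 'e) chart \<Rightarrow> 'm \<Rightarrow> 'e \<Rightarrow> 'e" where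
  "tangent_coord A c x v =
     frechet_derivative (snd c \<circ> chart_inv (chart_at A x)) (at (snd (chart_at A x) x)) v"

definition tangent_atlas ::
  "('m, 'e::euclidean_space) chart set \<Rightarrow> ('m \<times> 'e, 'e \<times> 'e) chart set" where
  "tangent_atlas A =
     (\<lambda>c. (fst c \<times> UNIV, \<lambda>(x, v). (snd c x, tangent_coord A c x v))) ` A"

(* Whitney sum of the tangent bundle with itself: points (x, u, w) with u, w tangent at x. *)
definition whitney_atlas ::
  "('m, 'e::euclidean_space) chart set \<Rightarrow> ('m \<times> 'e \<times> 'e, 'e \<times> 'e \<times> 'e) chart set" where
  "whitney_atlas A =
     (\<lambda>c. (fst c \<times> UNIV,
           \<lambda>(x, u, w). (snd c x, tangent_coord A c x u, tangent_coord A c x w))) ` A"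

definition riemannian_metric ::
  "('m, 'e::euclidean_space) chart set \<Rightarrow> ('m \<Rightarrow> 'e \<Rightarrow> 'e \<Rightarrow> real) \<Rightarrow> bool" where
  "riemannian_metric A g \<longleftrightarrow>
     (\<forall>x. bilinear (g x) \<and> (\<forall>u w. g x u w = g x w u) \<and> (\<forall>u. u \<noteq> 0 \<longrightarrow> 0 < g x u u)) \<and>
     (\<forall>k. Ck_fun k (whitney_atlas A) (\<lambda>(x, u, w). g x u w))"

definition rnorm :: "('m \<Rightarrow> 'e \<Rightarrow> 'e \<Rightarrow> real) \<Rightarrow> 'm \<Rightarrow> 'e \<Rightarrow> real" where
  "rnorm g x v = sqrt (g x v v)"

definition covector_norm ::
  "('m \<Rightarrow> 'e \<Rightarrow> 'e \<Rightarrow> real) \<Rightarrow> 'm \<Rightarrow> ('e \<Rightarrow> real) \<Rightarrow> real" where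
  "covector_norm g x \<omega> = (SUP w\<in>{w. rnorm g x w = 1}. \<bar>\<omega> w\<bar>)"

definition differential ::
  "('m, 'e::euclidean_space) chart set \<Rightarrow> ('m \<Rightarrow> real) \<Rightarrow> 'm \<Rightarrow> 'e \<Rightarrow> real" where
  "differential A f x w =
     frechet_derivative (f \<circ> chart_inv (chart_at A x)) (at (snd (chart_at A x) x)) w"

definition rgrad ::
  "('m, 'e::euclidean_space) chart set \<Rightarrow> ('m \<Rightarrow> 'e \<Rightarrow> 'e \<Rightarrow> real) \<Rightarrow> ('m \<Rightarrow> real) \<Rightarrow> 'm \<Rightarrow> 'e" where
  "rgrad A g f x = (THE u. \<forall>w. g x u w = differential A f x w)"


section \<open>Retractions and vector transports\<close>

(* The derivative condition is read in the chart used to identify the tangent space at x with 'e. *)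
definition manifold_retraction ::
  "('m, 'e::euclidean_space) chart set \<Rightarrow> ('m \<Rightarrow> 'e \<Rightarrow> 'm) \<Rightarrow> bool" where
  "manifold_retraction A R \<longleftrightarrow>
     smooth_map (tangent_atlas A) A (\<lambda>(x, v). R x v) \<and>
     (\<forall>x. R x 0 = x \<and> ((\<lambda>v. snd (chart_at A x) (R x v)) has_derivative (\<lambda>v. v)) (at 0))"

(* VT x u is the transport from the tangent space at x to the tangent space at R x u. *)
definition vector_transport ::
  "('m, 'e::euclidean_space) chart set \<Rightarrow> ('m \<Rightarrow> 'e \<Rightarrow> 'm) \<Rightarrow> ('m \<Rightarrow> 'e \<Rightarrow> 'e \<Rightarrow> 'e) \<Rightarrow> bool" where
  "vector_transport A R VT \<longleftrightarrow>
     (\<forall>x u. linear (VT x u)) \<and> (\<forall>x w. VT x 0 w = w) \<and>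
     smooth_map (whitney_atlas A) (tangent_atlas A) (\<lambda>(x, u, w). (R x u, VT x u w))"

(* s is a singular value of T : (E, g1) \<rightarrow> (E, g2) if s^2 is an eigenvalue of T* T; the equation
   T* T w = s^2 w is written by pairing it with every z, which spares naming the adjoint T*. *)
definition singular_value ::
  "('e::real_vector \<Rightarrow> 'e \<Rightarrow> real) \<Rightarrow> ('e \<Rightarrow> 'e \<Rightarrow> real) \<Rightarrow> ('e \<Rightarrow> 'e) \<Rightarrow> real \<Rightarrow> bool" where
  "singular_value g1 g2 T s \<longleftrightarrow>
     0 \<le> s \<and> (\<exists>w. w \<noteq> 0 \<and> (\<forall>z. g2 (T w) (T z) = s\<^sup>2 * g1 w z))"

definition sigma_min ::
  "('e::real_vector \<Rightarrow> 'e \<Rightarrow> real) \<Rightarrow> ('e \<Rightarrow> 'e \<Rightarrow> real) \<Rightarrow> ('e \<Rightarrow> 'e) \<Rightarrow> real" where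
  "sigma_min g1 g2 T = (LEAST s. singular_value g1 g2 T s)"


section \<open>Assumptions on a set of tangent vectors\<close>

definition pullback :: "('m \<Rightarrow> real) \<Rightarrow> ('m \<Rightarrow> 'e \<Rightarrow> 'm) \<Rightarrow> 'm \<Rightarrow> 'e \<Rightarrow> real" where
  "pullback f R x = (\<lambda>v. f (R x v))"

definition majorization_smooth ::
  "real \<Rightarrow> nat \<Rightarrow> ('m \<Rightarrow> 'e \<Rightarrow> 'e \<Rightarrow> real) \<Rightarrow> ('m \<Rightarrow> 'e \<Rightarrow> 'm) \<Rightarrow> ('m \<Rightarrow> real) \<Rightarrow>
    ('m \<times> 'e::real_normed_vector) set \<Rightarrow> bool" where
  "majorization_smooth L p g R f S \<longleftrightarrow>
     (\<forall>(x, v)\<in>S. pullback f R x v \<le>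
        taylor p (pullback f R x) v + L / real (p + 1) * rnorm g x v ^ (p + 1))"

(* The Taylor expansion of the covector-valued map D(pullback) is taken after evaluation at w. *)
definition transport_smooth ::
  "real \<Rightarrow> nat \<Rightarrow> ('m \<Rightarrow> 'e \<Rightarrow> 'e \<Rightarrow> real) \<Rightarrow> ('m \<Rightarrow> 'e \<Rightarrow> 'm) \<Rightarrow> ('m \<Rightarrow> 'e \<Rightarrow> 'e \<Rightarrow> 'e) \<Rightarrow>
    ('m \<Rightarrow> real) \<Rightarrow> ('m \<times> 'e::real_normed_vector) set \<Rightarrow> bool" where
  "transport_smooth L p g R VT f S \<longleftrightarrow>
     (\<forall>(x, v)\<in>S.
        covector_norm g x (\<lambda>w.
            frechet_derivative (pullback f R (R x v)) (at 0) (VT x v w)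
          - taylor (p - 1) (\<lambda>y. frechet_derivative (pullback f R x) (at y) w) v)
        \<le> real p / real (p + 1) * L * rnorm g x v ^ p)"

(* The infimum over an empty set is read as plus infinity. *)
definition short_step_lower_bound ::
  "real \<Rightarrow> real \<Rightarrow> ('m \<Rightarrow> 'e \<Rightarrow> 'e \<Rightarrow> real) \<Rightarrow> ('m \<Rightarrow> 'e \<Rightarrow> 'm) \<Rightarrow> ('m \<Rightarrow> 'e \<Rightarrow> 'e \<Rightarrow> 'e) \<Rightarrow>
    ('m \<times> 'e::real_vector) set \<Rightarrow> bool" where
  "short_step_lower_bound r b g R VT S \<longleftrightarrow>
     (\<forall>(x, v)\<in>S. rnorm g x v \<le> r \<longrightarrow> b \<le> sigma_min (g x) (g (R x v)) (VT x v))"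


section \<open>The algorithm\<close>

record rar_params =
  theta :: real
  eta1 :: real
  eta2 :: real
  gamma1 :: real
  gamma2 :: real
  gamma3 :: real
  alpha_min :: real
  alpha_init :: real

definition valid_params :: "rar_params \<Rightarrow> bool" where
  "valid_params P \<longleftrightarrow>
     0 < theta P \<and> 0 < alpha_min P \<and> alpha_min P \<le> alpha_init P \<and>
     0 < eta1 P \<and> eta1 P \<le> eta2 P \<and> eta2 P < 1 \<and>
     0 < gamma1 P \<and> gamma1 P < 1 \<and> 1 < gamma2 P \<and> gamma2 P < gamma3 P"

definition rar_model ::
  "nat \<Rightarrow> ('m \<Rightarrow> 'e \<Rightarrow> 'e \<Rightarrow> real) \<Rightarrow> ('m \<Rightarrow> 'e \<Rightarrow> 'm) \<Rightarrow> ('m \<Rightarrow> real) \<Rightarrow>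
    real \<Rightarrow> 'm \<Rightarrow> 'e::real_normed_vector \<Rightarrow> real" where
  "rar_model p g R f \<alpha> x v =
     taylor p (pullback f R x) v + \<alpha> / real (p + 1) * rnorm g x v ^ (p + 1)"

definition rar_ratio ::
  "nat \<Rightarrow> ('m \<Rightarrow> 'e \<Rightarrow> 'm) \<Rightarrow> ('m \<Rightarrow> real) \<Rightarrow> 'm \<Rightarrow> 'e::real_normed_vector \<Rightarrow> real" where
  "rar_ratio p R f x v = (f x - f (R x v)) / (f x - taylor p (pullback f R x) v)"

(* One iteration that does not stop: from iterate x and weight \<alpha>, with increment v, to x' and \<alpha>'. *)
definition rar_step ::
  "nat \<Rightarrow> rar_params \<Rightarrow> ('m \<Rightarrow> 'e \<Rightarrow> 'e \<Rightarrow> real) \<Rightarrow> ('m \<Rightarrow> 'e \<Rightarrow> 'm) \<Rightarrow> ('m \<Rightarrow> real) \<Rightarrow>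
    'm \<Rightarrow> real \<Rightarrow> 'e::real_normed_vector \<Rightarrow> 'm \<Rightarrow> real \<Rightarrow> bool" where
  "rar_step p P g R f x \<alpha> v x' \<alpha>' \<longleftrightarrow>
     rar_model p g R f \<alpha> x v \<le> rar_model p g R f \<alpha> x 0 \<and>
     covector_norm g x (frechet_derivative (rar_model p g R f \<alpha> x) (at v))
       \<le> theta P * rnorm g x v ^ p \<and>
     (let \<rho> = rar_ratio p R f x v in
        x' = (if eta1 P \<le> \<rho> then R x v else x) \<and>
        (if eta2 P \<le> \<rho> then \<alpha>' \<in> {max (alpha_min P) (gamma1 P * \<alpha>)..\<alpha>}
         else if eta1 P \<le> \<rho> then \<alpha>' \<in> {\<alpha>..gamma2 P * \<alpha>}
         else \<alpha>' \<in> {gamma2 P * \<alpha>..gamma3 P * \<alpha>}))"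

(* A complete run with K steps; K = \<infinity> if the stopping test never succeeds.  If K = enat n, the
   run returns x n; entries of x, \<alpha> beyond index n, and of v from index n on, are irrelevant. *)
definition rar_run ::
  "nat \<Rightarrow> rar_params \<Rightarrow> real \<Rightarrow> ('m, 'e::euclidean_space) chart set \<Rightarrow>
    ('m \<Rightarrow> 'e \<Rightarrow> 'e \<Rightarrow> real) \<Rightarrow> ('m \<Rightarrow> 'e \<Rightarrow> 'm) \<Rightarrow> ('m \<Rightarrow> real) \<Rightarrow> 'm \<Rightarrow>
    (nat \<Rightarrow> 'm) \<Rightarrow> (nat \<Rightarrow> real) \<Rightarrow> (nat \<Rightarrow> 'e) \<Rightarrow> enat \<Rightarrow> bool" where
  "rar_run p P \<epsilon> A g R f x0 x \<alpha> v K \<longleftrightarrow>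
     x 0 = x0 \<and> \<alpha> 0 = alpha_init P \<and>
     (\<forall>i. enat i < K \<longrightarrow>
        \<not> rnorm g (x i) (rgrad A g f (x i)) \<le> \<epsilon> \<and>
        rar_step p P g R f (x i) (\<alpha> i) (v i) (x (Suc i)) (\<alpha> (Suc i))) \<and>
     (\<forall>n. K = enat n \<longrightarrow> rnorm g (x n) (rgrad A g f (x n)) \<le> \<epsilon>)"

definition rar_increments :: "(nat \<Rightarrow> 'm) \<Rightarrow> (nat \<Rightarrow> 'e) \<Rightarrow> enat \<Rightarrow> ('m \<times> 'e) set" where
  "rar_increments x v K = {(x i, v i) | i. enat i < K}"

(* The log of oracle calls of a run with n steps, an entry (k, y) being a call of the k-th oracle
   y \<mapsto> D^k(pullback f R y)(0).  Every visited x i is charged all orders 0..p (stopping test and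
   model), and every step one call of order 0 at R (x i) (v i), which returns the value f (R (x i)
   (v i)) in the ratio.  Nothing is cached when a step is rejected. *)
definition oracle_calls ::
  "nat \<Rightarrow> ('m \<Rightarrow> 'e \<Rightarrow> 'm) \<Rightarrow> (nat \<Rightarrow> 'm) \<Rightarrow> (nat \<Rightarrow> 'e) \<Rightarrow> nat \<Rightarrow> (nat \<times> 'm) list" where
  "oracle_calls p R x v n =
     concat (map (\<lambda>i. map (\<lambda>k. (k, x i)) [0..<Suc p] @ [(0, R (x i) (v i))]) [0..<n])
     @ map (\<lambda>k. (k, x n)) [0..<Suc p]"


section \<open>The constant in the complexity bound\<close>

(* The constant must not depend on the manifold or its dimension, which are types here.  An
   existential quantifier in a theorem lies inside the implicit quantification over type variables
   and could not express this, so the constant is a function of the permitted data only.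

   \<Delta> is the gap f(x0) - inf f; write E = (L/\<epsilon>)^((p+1)/p).  Weights stay below
   max \<alpha>_0 (\<gamma>_3 L/(1-\<eta>_2)), whence \<kappa>; a successful step with nonstationary successor decreases f
   by at least \<delta>/E; N E bounds the number of successful steps, and the last two summands absorb
   the rejected steps and the final stopping test. *)
definition rar_const ::
  "nat \<Rightarrow> rar_params \<Rightarrow> real \<Rightarrow> real \<Rightarrow> real \<Rightarrow> real \<Rightarrow> real \<Rightarrow> real" where
  "rar_const p P r b \<Delta> L0 \<epsilon>0 =
    (let q = real (p + 1) / real p;
         \<kappa> = 1 + gamma3 P / (1 - eta2 P) + (theta P + alpha_init P) / L0;
         \<delta> = eta1 P * alpha_min P / real (p + 1) *
               min (r ^ (p + 1) * (L0 / \<epsilon>0) powr q) ((b / \<kappa>) powr q);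
         N = \<Delta> / \<delta> + (\<epsilon>0 / L0) powr q;
         B = gamma3 P / ((1 - eta2 P) * alpha_init P) * \<epsilon>0 * (\<epsilon>0 / L0) powr (1 / real p)
     in real (p + 3) *
        (N * (1 + ln (1 / gamma1 P) / ln (gamma2 P)) + B / ln (gamma2 P) + (\<epsilon>0 / L0) powr q))"

end

theory Submission
  imports Defs
begin

text \<open>Majorization gives \<open>\<rho>\<^sub>i \<ge> 1 - L / \<alpha>\<^sub>i\<close>, so the weights stay below a multiple of \<open>L\<close>. A successful
  step decreases \<open>f\<close> by a multiple of \<open>\<parallel>v\<^sub>i\<parallel>^(p+1)\<close>. If \<open>\<parallel>v\<^sub>i\<parallel> \<le> r\<close>, then the model gradient test, the
  transported derivative estimate and the lower bound on the singular values of the transport give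
  \<open>b \<parallel>grad f (R v\<^sub>i)\<parallel> \<le> \<kappa> L \<parallel>v\<^sub>i\<parallel>^p\<close>. A successful step to a nonstationary point therefore decreases
  \<open>f\<close> by at least \<open>\<delta> (\<epsilon> / L)^((p+1)/p)\<close>, which bounds the number of successful steps; the rejected
  steps are bounded by comparing the growth of \<open>\<alpha>\<^sub>i\<close> with its upper bound.\<close>

section \<open>Functions of class \<open>C\<^sup>k\<close> and Taylor polynomials\<close>

text \<open>The gradient test concerns the derivative of a Taylor polynomial, whereas
  \<open>transport_smooth\<close> concerns the Taylor polynomial of a derivative. They agree because
  mixed derivatives commute, so symmetry has to be proved for \<open>hderiv\<close>, which sees
  derivatives only along fixed lists of directions. Operator norms, gradients and least singular
  values are given by SUP, THE and LEAST; each needs an attained bound or a unique witness before an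
  estimate can use it. Two kinds of successful steps escape the short-step estimate: those longer
  than r, which decrease f by at least a fixed amount, and a final one, whose successor may be
  stationary. Fixed amounts become multiples of (L/\<epsilon>)^((p+1)/p) through L/\<epsilon> \<ge>
  L0/\<epsilon>0, which is how L0 and \<epsilon>0 enter the constant. The counts hold for every
  finite prefix of a run, so termination is a consequence of them.\<close>

lemma frechet_derivative_cong_open:
  assumes "open S" "x \<in> S" "\<And>y. y \<in> S \<Longrightarrow> f y = g y"
  shows "frechet_derivative f (at x) = frechet_derivative g (at x)"
proof -
  have "(f has_derivative D) (at x) \<longleftrightarrow> (g has_derivative D) (at x)" for D
    using assms by (metis has_derivative_transform_within_open)
  then show ?thesis
    by (simp add: frechet_derivative_def)
qed

lemma frechet_derivative_eqI:
  "(f has_derivative D) (at x) \<Longrightarrow> frechet_derivative f (at x) = D"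
  by (rule frechet_derivative_at[symmetric])

lemma has_derivative_frechet:
  "f differentiable (at x) \<Longrightarrow> (f has_derivative frechet_derivative f (at x)) (at x)"
  by (simp add: frechet_derivative_works)

lemma Ck_on_Suc_imp: "Ck_on (Suc k) S f \<Longrightarrow> Ck_on k S f"
proof (induction k arbitrary: f)
  case 0
  then show ?case
    by (auto intro!: continuous_at_imp_continuous_on differentiable_imp_continuous_within)
next
  case (Suc k)
  then show ?case by simp
qed

lemma Ck_on_le: "Ck_on n S f \<Longrightarrow> k \<le> n \<Longrightarrow> Ck_on k S f"
  by (induction n) (auto simp: le_Suc_eq simp del: Ck_on.simps dest: Ck_on_Suc_imp)

lemma Ck_on_imp_differentiable:
  assumes "Ck_on k S f" "1 \<le> k" "x \<in> S"
  shows "f differentiable (at x)"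
  using assms by (cases k) auto

lemma Ck_on_cong:
  assumes "open S" "\<And>x. x \<in> S \<Longrightarrow> f x = g x" "Ck_on k S f"
  shows "Ck_on k S g"
  using assms(2,3)
proof (induction k arbitrary: f g)
  case 0
  then show ?case by (metis Ck_on.simps(1) continuous_on_cong)
next
  case (Suc k)
  have "g differentiable (at x)" if "x \<in> S" for x
    using Suc.prems assms(1) that
    by (metis Ck_on.simps(2) differentiable_def has_derivative_transform_within_open)
  moreover have "Ck_on k S (\<lambda>x. frechet_derivative g (at x) v)" for v
  proof (rule Suc.IH[where f = "\<lambda>x. frechet_derivative f (at x) v"])
    show "frechet_derivative f (at x) v = frechet_derivative g (at x) v" if "x \<in> S" for x
      by (rule arg_cong[OF frechet_derivative_cong_open[OF assms(1) that Suc.prems(1)]])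
    show "Ck_on k S (\<lambda>x. frechet_derivative f (at x) v)"
      using Suc.prems by simp
  qed
  ultimately show ?case by simp
qed

text \<open>Meant for pullbacks: \<open>R x v\<close> may lie in a different chart for each v, so
  differentiability is visible only near each v. The recursion passes to directional derivatives on
  the same neighbourhoods.\<close>

lemma Ck_on_locally:
  assumes "\<And>x. x \<in> S \<Longrightarrow> \<exists>U. open U \<and> x \<in> U \<and> Ck_on k U f"
  shows "Ck_on k S f"
  using assms
proof (induction k arbitrary: f)
  case 0
  then show ?case
    by (metis Ck_on.simps(1) continuous_at_imp_continuous_on continuous_on_eq_continuous_at)
next
  case (Suc k)
  have "f differentiable (at x)" if "x \<in> S" for x
    using Suc.prems[OF that] by auto
  moreover have "Ck_on k S (\<lambda>x. frechet_derivative f (at x) v)" for v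
  proof (rule Suc.IH)
    show "\<exists>U. open U \<and> x \<in> U \<and> Ck_on k U (\<lambda>x. frechet_derivative f (at x) v)" if "x \<in> S" for x
      using Suc.prems[OF that] by auto
  qed
  ultimately show ?case by simp
qed

lemma Ck_on_const: "Ck_on k S (\<lambda>x. c)"
  by (induction k arbitrary: c) auto

lemma Ck_on_add:
  assumes "open S" "Ck_on k S f" "Ck_on k S g"
  shows "Ck_on k S (\<lambda>x. f x + g x)"
  using assms(2,3)
proof (induction k arbitrary: f g)
  case 0
  then show ?case by (auto intro: continuous_on_add)
next
  case (Suc k)
  have "Ck_on k S (\<lambda>x. frechet_derivative (\<lambda>y. f y + g y) (at x) v)" for v
  proof (rule Ck_on_cong[OF assms(1)])
    show "Ck_on k S (\<lambda>x. frechet_derivative f (at x) v + frechet_derivative g (at x) v)"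
      using Suc by simp
    show "frechet_derivative f (at x) v + frechet_derivative g (at x) v
        = frechet_derivative (\<lambda>y. f y + g y) (at x) v" if "x \<in> S" for x
    proof -
      have "f differentiable (at x)" "g differentiable (at x)"
        using Suc.prems that by auto
      from frechet_derivative_eqI[OF has_derivative_add[OF this[THEN has_derivative_frechet]]]
      show ?thesis by simp
    qed
  qed
  then show ?case using Suc.prems by auto
qed

lemma Ck_on_sum:
  assumes "open S" "finite I" "\<And>i. i \<in> I \<Longrightarrow> Ck_on k S (f i)"
  shows "Ck_on k S (\<lambda>x. \<Sum>i\<in>I. f i x)"
  using assms(2,3)
  by (induction I rule: finite_induct) (simp_all add: Ck_on_const Ck_on_add assms(1))

lemma Ck_on_scaleR:
  assumes "open S" "Ck_on k S c" "Ck_on k S f"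
  shows "Ck_on k S (\<lambda>x. c x *\<^sub>R f x)"
  using assms(2,3)
proof (induction k arbitrary: c f)
  case 0
  then show ?case by (auto intro: continuous_on_scaleR)
next
  case (Suc k)
  have "Ck_on k S (\<lambda>x. frechet_derivative (\<lambda>y. c y *\<^sub>R f y) (at x) v)" for v
  proof (rule Ck_on_cong[OF assms(1)])
    show "Ck_on k S (\<lambda>x. c x *\<^sub>R frechet_derivative f (at x) v
                        + frechet_derivative c (at x) v *\<^sub>R f x)"
      using Suc Ck_on_Suc_imp[OF Suc.prems(1)] Ck_on_Suc_imp[OF Suc.prems(2)]
      by (intro Ck_on_add[OF assms(1)] Suc.IH) auto
    show "c x *\<^sub>R frechet_derivative f (at x) v + frechet_derivative c (at x) v *\<^sub>R f x
        = frechet_derivative (\<lambda>y. c y *\<^sub>R f y) (at x) v" if "x \<in> S" for x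
    proof -
      have "c differentiable (at x)" "f differentiable (at x)"
        using Suc.prems that by auto
      from frechet_derivative_eqI[OF has_derivative_scaleR[OF this[THEN has_derivative_frechet]]]
      show ?thesis by simp
    qed
  qed
  then show ?case using Suc.prems by auto
qed

lemma Ck_on_bounded_linear_compose:
  assumes "open S" "bounded_linear h" "Ck_on k S f"
  shows "Ck_on k S (\<lambda>x. h (f x))"
  using assms(3)
proof (induction k arbitrary: f)
  case 0
  then show ?case
    using assms(2) by (auto intro: bounded_linear.continuous_on)
next
  case (Suc k)
  have *: "((\<lambda>x. h (f x)) has_derivative (\<lambda>v. h (frechet_derivative f (at x) v))) (at x)"
    if "x \<in> S" for x
    using Suc.prems that
    by (auto intro!: bounded_linear.has_derivative[OF assms(2)] has_derivative_frechet)
  have "Ck_on k S (\<lambda>x. frechet_derivative (\<lambda>y. h (f y)) (at x) v)" for v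
    by (rule Ck_on_cong[OF assms(1)  _ Suc.IH[of "\<lambda>x. frechet_derivative f (at x) v"]])
       (use Suc.prems in \<open>auto simp: frechet_derivative_eqI[OF *]\<close>)
  then show ?case using * by (auto simp: differentiable_def)
qed

lemma linear_Basis_expansion:
  fixes h :: "'a::euclidean_space \<Rightarrow> 'b::real_vector"
  assumes "linear h"
  shows "h v = (\<Sum>b\<in>Basis. (v \<bullet> b) *\<^sub>R h b)"
proof -
  have "h v = h (\<Sum>b\<in>Basis. (v \<bullet> b) *\<^sub>R b)"
    by (simp add: euclidean_representation)
  also have "\<dots> = (\<Sum>b\<in>Basis. (v \<bullet> b) *\<^sub>R h b)"
    using assms by (simp add: linear_sum linear_scale)
  finally show ?thesis .
qed

text \<open>By the chain rule h is differentiated in the direction Df(x)[v], which moves with x,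
  while \<open>Ck_on\<close> controls fixed directions only. Expanding that direction in
  \<open>Basis\<close> leaves products of C^k functions. The induction varies h and keeps f.\<close>

lemma Ck_on_compose:
  fixes f :: "'a::euclidean_space \<Rightarrow> 'b::euclidean_space"
  assumes "open S" "Ck_on k S f" "Ck_on k T h" "\<And>x. x \<in> S \<Longrightarrow> f x \<in> T"
  shows "Ck_on k S (\<lambda>x. h (f x))"
  using assms(2,3)
proof (induction k arbitrary: h)
  case 0
  then show ?case
    using assms(4) by (auto intro: continuous_on_compose2)
next
  case (Suc k)
  have diff: "f differentiable (at x)" "h differentiable (at (f x))" if "x \<in> S" for x
    using Suc.prems that assms(4) by auto
  have der: "((\<lambda>x. h (f x)) has_derivative
      (\<lambda>v. frechet_derivative h (at (f x)) (frechet_derivative f (at x) v))) (at x)"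
    if "x \<in> S" for x
    using has_derivative_compose[OF diff[OF that, THEN has_derivative_frechet]] .
  have "Ck_on k S (\<lambda>x. frechet_derivative (\<lambda>y. h (f y)) (at x) v)" for v
  proof (rule Ck_on_cong[OF assms(1)])
    show "Ck_on k S (\<lambda>x. \<Sum>b\<in>Basis. (frechet_derivative f (at x) v \<bullet> b) *\<^sub>R
                            frechet_derivative h (at (f x)) b)"
    proof (intro Ck_on_sum Ck_on_scaleR assms(1) finite_Basis)
      fix b :: 'b
      show "Ck_on k S (\<lambda>x. frechet_derivative f (at x) v \<bullet> b)"
        using Suc.prems
        by (intro Ck_on_bounded_linear_compose[OF assms(1) bounded_linear_inner_left]) auto
      show "Ck_on k S (\<lambda>x. frechet_derivative h (at (f x)) b)"
        using Suc.prems Ck_on_Suc_imp by (intro Suc.IH) auto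
    qed
    show "(\<Sum>b\<in>Basis. (frechet_derivative f (at x) v \<bullet> b) *\<^sub>R frechet_derivative h (at (f x)) b)
        = frechet_derivative (\<lambda>y. h (f y)) (at x) v" if "x \<in> S" for x
      using linear_Basis_expansion[OF linear_frechet_derivative[OF diff(2)[OF that]],
          of "frechet_derivative f (at x) v"]
      by (simp add: frechet_derivative_eqI[OF der[OF that]])
  qed
  then show ?case using der by (auto simp: differentiable_def)
qed

section \<open>Symmetry of higher derivatives\<close>

lemma second_difference_mean_value:
  fixes f :: "'a::euclidean_space \<Rightarrow> real"
  assumes "Ck_on (Suc (Suc k)) UNIV f" "0 < h"
  obtains s t where "0 < s" "s < h" "0 < t" "t < h"
    "f (x + h *\<^sub>R u + h *\<^sub>R v) - f (x + h *\<^sub>R u) - f (x + h *\<^sub>R v) + f x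
       = h * h * hderiv f [v, u] (x + s *\<^sub>R u + t *\<^sub>R v)"
proof -
  have diff: "f differentiable (at y)" "(\<lambda>y. frechet_derivative f (at y) u) differentiable (at y)" for y
    using assms by auto
  have chain: "((\<lambda>s. F (a + s *\<^sub>R w)) has_real_derivative frechet_derivative F (at (a + s *\<^sub>R w)) w) (at s)"
    if "\<And>y. F differentiable (at y)" for F :: "'a \<Rightarrow> real" and a w s
  proof -
    have lin: "linear (frechet_derivative F (at (a + s *\<^sub>R w)))"
      using linear_frechet_derivative[OF that] .
    have "((\<lambda>s. a + s *\<^sub>R w) has_derivative (\<lambda>d. d *\<^sub>R w)) (at s)"
      by (auto intro!: derivative_eq_intros)
    from has_derivative_compose[OF this has_derivative_frechet[OF that]]
    show ?thesis
      by (simp add: has_field_derivative_def linear_scale[OF lin] mult_commute_abs)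
  qed
  have "\<exists>s>0. s < h \<and> (f (x + h *\<^sub>R v + h *\<^sub>R u) - f (x + h *\<^sub>R u)) - (f (x + h *\<^sub>R v + 0 *\<^sub>R u) - f (x + 0 *\<^sub>R u))
      = (h - 0) * (frechet_derivative f (at (x + h *\<^sub>R v + s *\<^sub>R u)) u - frechet_derivative f (at (x + s *\<^sub>R u)) u)"
    by (intro MVT2[OF \<open>0 < h\<close>]) (intro DERIV_diff chain diff)
  then obtain s where s: "0 < s" "s < h"
    "f (x + h *\<^sub>R u + h *\<^sub>R v) - f (x + h *\<^sub>R u) - f (x + h *\<^sub>R v) + f x
       = h * (frechet_derivative f (at (x + s *\<^sub>R u + h *\<^sub>R v)) u - frechet_derivative f (at (x + s *\<^sub>R u)) u)"
    by (auto simp: algebra_simps)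
  have "\<exists>t>0. t < h \<and> frechet_derivative f (at (x + s *\<^sub>R u + h *\<^sub>R v)) u - frechet_derivative f (at (x + s *\<^sub>R u + 0 *\<^sub>R v)) u
      = (h - 0) * hderiv f [v, u] (x + s *\<^sub>R u + t *\<^sub>R v)"
    unfolding hderiv.simps by (intro MVT2[OF \<open>0 < h\<close>]) (intro chain diff)
  with s that show thesis by auto
qed

text \<open>The second difference is symmetric in u and v, so the two mixed derivatives take a
  common value at points arbitrarily close to x; continuity at x does the rest.\<close>

lemma hderiv_2_commute:
  fixes f :: "'a::euclidean_space \<Rightarrow> real"
  assumes f: "Ck_on (Suc (Suc k)) UNIV f"
  shows "hderiv f [u, v] = hderiv f [v, u]"
proof
  fix x
  have cont: "isCont (hderiv f [u, v]) x" for u v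
  proof -
    have "Ck_on k UNIV (hderiv f [u, v])"
      using f by simp
    then have "Ck_on 0 UNIV (hderiv f [u, v])"
      by (rule Ck_on_le) simp
    then show ?thesis
      by (simp add: continuous_on_eq_continuous_at)
  qed
  have "\<bar>hderiv f [u, v] x - hderiv f [v, u] x\<bar> \<le> e" if "0 < e" for e
  proof -
    obtain d1 where d1: "0 < d1" "\<And>y. dist y x < d1 \<Longrightarrow> \<bar>hderiv f [u, v] y - hderiv f [u, v] x\<bar> < e / 2"
      using cont[of u v] \<open>0 < e\<close> unfolding continuous_at_eps_delta dist_real_def
      by (meson half_gt_zero)
    obtain d2 where d2: "0 < d2" "\<And>y. dist y x < d2 \<Longrightarrow> \<bar>hderiv f [v, u] y - hderiv f [v, u] x\<bar> < e / 2"
      using cont[of v u] \<open>0 < e\<close> unfolding continuous_at_eps_delta dist_real_def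
      by (meson half_gt_zero)
    \<comment> \<open>The summand 1 keeps N positive when u = v = 0. With h = min d1 d2 / N all
      intermediate points stay within both continuity radii.\<close>
    define N where "N = norm u + norm v + 1"
    define h where "h = min d1 d2 / N"
    have N: "0 < N"
      unfolding N_def by (smt (verit) norm_ge_zero)
    then have h: "0 < h"
      using d1(1) d2(1) by (simp add: h_def)
    have near: "dist (x + s *\<^sub>R u' + t *\<^sub>R v') x < min d1 d2"
      if "0 < s" "s < h" "0 < t" "t < h" "norm u' + norm v' + 1 = N" for s t u' v'
    proof -
      have "dist (x + s *\<^sub>R u' + t *\<^sub>R v') x \<le> s * norm u' + t * norm v'"
        using norm_triangle_ineq[of "s *\<^sub>R u'" "t *\<^sub>R v'"] that by (simp add: dist_norm add.assoc)
      also have "\<dots> \<le> h * norm u' + h * norm v'"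
        using that by (intro add_mono mult_right_mono) auto
      also have "\<dots> < h * N"
        using h that(5) by (simp add: distrib_left[symmetric] mult_strict_left_mono)
      finally show ?thesis
        using N by (simp add: h_def)
    qed
    obtain s t where st: "0 < s" "s < h" "0 < t" "t < h"
      "f (x + h *\<^sub>R u + h *\<^sub>R v) - f (x + h *\<^sub>R u) - f (x + h *\<^sub>R v) + f x
         = h * h * hderiv f [v, u] (x + s *\<^sub>R u + t *\<^sub>R v)"
      using second_difference_mean_value[OF f h] .
    obtain s' t' where st': "0 < s'" "s' < h" "0 < t'" "t' < h"
      "f (x + h *\<^sub>R v + h *\<^sub>R u) - f (x + h *\<^sub>R v) - f (x + h *\<^sub>R u) + f x
         = h * h * hderiv f [u, v] (x + s' *\<^sub>R v + t' *\<^sub>R u)"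
      using second_difference_mean_value[OF f h] .
    have "h * h * hderiv f [v, u] (x + s *\<^sub>R u + t *\<^sub>R v) = h * h * hderiv f [u, v] (x + s' *\<^sub>R v + t' *\<^sub>R u)"
      using st(5) st'(5) by (simp add: algebra_simps)
    then have "hderiv f [v, u] (x + s *\<^sub>R u + t *\<^sub>R v) = hderiv f [u, v] (x + s' *\<^sub>R v + t' *\<^sub>R u)"
      using h by simp
    moreover have "\<bar>hderiv f [v, u] (x + s *\<^sub>R u + t *\<^sub>R v) - hderiv f [v, u] x\<bar> < e / 2"
      using near[OF st(1-4), of u v] by (intro d2) (simp add: N_def)
    moreover have "\<bar>hderiv f [u, v] (x + s' *\<^sub>R v + t' *\<^sub>R u) - hderiv f [u, v] x\<bar> < e / 2"
      using near[OF st'(1-4), of v u] by (intro d1) (simp add: N_def)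
    ultimately show ?thesis by linarith
  qed
  then have "\<bar>hderiv f [u, v] x - hderiv f [v, u] x\<bar> \<le> 0"
    by (rule field_le_epsilon[of _ 0, simplified])
  then show "hderiv f [u, v] x = hderiv f [v, u] x" by simp
qed

lemma hderiv_append: "hderiv f (us @ vs) = hderiv (hderiv f vs) us"
  by (induction us) auto

lemma Ck_on_hderiv: "Ck_on (n + length vs) S f \<Longrightarrow> Ck_on n S (hderiv f vs)"
proof (induction vs arbitrary: n)
  case (Cons v vs)
  then have "Ck_on (Suc n) S (hderiv f vs)" by (simp del: Ck_on.simps)
  then show ?case by simp
qed simp

text \<open>Each swap of neighbours is \<open>hderiv_2_commute\<close> for the function given by the
  directions to the right of the pair. It still has two continuous derivatives, because f has as
  many as the list is long.\<close>

lemma hderiv_move_front: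
  fixes f :: "'a::euclidean_space \<Rightarrow> real"
  assumes "Ck_on (Suc (length us + length vs)) UNIV f"
  shows "hderiv f (us @ u # vs) = hderiv f (u # us @ vs)"
  using assms
proof (induction us)
  case (Cons w us)
  have "Ck_on (Suc (Suc 0)) UNIV (hderiv f (us @ vs))"
    using Cons.prems by (intro Ck_on_hderiv) simp
  from hderiv_2_commute[OF this]
  have "hderiv f (w # u # us @ vs) = hderiv f (u # w # us @ vs)" by simp
  moreover have "hderiv f (us @ u # vs) = hderiv f (u # us @ vs)"
    using Cons.prems by (intro Cons.IH) (simp add: Ck_on_Suc_imp del: Ck_on.simps)
  ultimately show ?case by simp
qed simp

lemma hderiv_Basis_expansion:
  fixes f :: "'a::euclidean_space \<Rightarrow> real"
  assumes "Ck_on (Suc (length vs)) UNIV f"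
  shows "hderiv f (v # vs) x = (\<Sum>b\<in>Basis. (v \<bullet> b) * hderiv f (b # vs) x)"
proof -
  have "Ck_on 1 UNIV (hderiv f vs)"
    using assms by (intro Ck_on_hderiv) simp
  then have "linear (frechet_derivative (hderiv f vs) (at x))"
    by (intro linear_frechet_derivative) simp
  from linear_Basis_expansion[OF this, of v] show ?thesis by simp
qed

text \<open>Expanding one of the repeated arguments in the basis makes the induction on \<open>j\<close> elementary;
  symmetry collects the two resulting sums.\<close>

lemma has_derivative_hderiv_replicate:
  fixes f :: "'a::euclidean_space \<Rightarrow> real"
  assumes "Ck_on (j + length us) UNIV f"
  shows "((\<lambda>v. hderiv f (replicate j v @ us) x) has_derivative
           (\<lambda>w. real j * hderiv f (w # replicate (j - 1) v @ us) x)) (at v)"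
  using assms
proof (induction j arbitrary: us)
  case 0
  then show ?case by simp
next
  case (Suc j)
  have C: "Ck_on (Suc (j + length us)) UNIV f"
    using Suc.prems by simp
  have expand: "hderiv f (replicate (Suc j) v @ us) x
      = (\<Sum>b\<in>Basis. (v \<bullet> b) * hderiv f (replicate j v @ b # us) x)" for v
    using C hderiv_Basis_expansion[of "replicate j v @ us" f v x]
    by (simp add: hderiv_move_front[of "replicate j v" us f] del: Ck_on.simps hderiv.simps)
  \<comment> \<open>The trailing list \<open>us\<close> exists for this step: the basis vector joins
    it, leaving one repeated argument fewer.\<close>
  have IH: "((\<lambda>v. hderiv f (replicate j v @ b # us) x) has_derivative
      (\<lambda>w. real j * hderiv f (w # replicate (j - 1) v @ b # us) x)) (at v)" for b
    using C by (intro Suc.IH) (simp del: Ck_on.simps)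
  have "((\<lambda>v. \<Sum>b\<in>Basis. (v \<bullet> b) * hderiv f (replicate j v @ b # us) x) has_derivative
      (\<lambda>w. \<Sum>b\<in>Basis. (v \<bullet> b) * (real j * hderiv f (w # replicate (j - 1) v @ b # us) x)
                      + (w \<bullet> b) * hderiv f (replicate j v @ b # us) x)) (at v)"
    by (intro has_derivative_sum has_derivative_mult has_derivative_inner_left
          has_derivative_ident IH)
  moreover have "(\<Sum>b\<in>Basis. (v \<bullet> b) * (real j * hderiv f (w # replicate (j - 1) v @ b # us) x)
                      + (w \<bullet> b) * hderiv f (replicate j v @ b # us) x)
       = real (Suc j) * hderiv f (w # replicate (Suc j - 1) v @ us) x" for w
  proof -
    have 1: "(\<Sum>b\<in>Basis. (w \<bullet> b) * hderiv f (replicate j v @ b # us) x)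
        = hderiv f (w # replicate j v @ us) x"
      using C hderiv_Basis_expansion[of "replicate j v @ us" f w x]
      by (simp add: hderiv_move_front[of "replicate j v" us f] del: Ck_on.simps hderiv.simps)
    \<comment> \<open>For j = 0 the factor \<open>real j\<close> kills the term with the truncated j
      - 1. Otherwise b moves to the front, the sum turns it into v, and one more swap puts w back at
      the head.\<close>
    have 2: "(\<Sum>b\<in>Basis. (v \<bullet> b) * (real j * hderiv f (w # replicate (j - 1) v @ b # us) x))
        = real j * hderiv f (w # replicate j v @ us) x"
    proof (cases j)
      case (Suc i)
      have "hderiv f (w # replicate i v @ b # us) x = hderiv f (b # w # replicate i v @ us) x" for b
        using C Suc hderiv_move_front[of "w # replicate i v" us f b]
        by (simp del: Ck_on.simps hderiv.simps)
      moreover have "hderiv f (w # v # replicate i v @ us) x = hderiv f (v # w # replicate i v @ us) x"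
        using C Suc hderiv_move_front[of "[w]" "replicate i v @ us" f v]
        by (simp del: Ck_on.simps hderiv.simps)
      ultimately show ?thesis
        using C Suc hderiv_Basis_expansion[of "w # replicate i v @ us" f v x]
        by (simp add: sum_distrib_left mult.left_commute del: Ck_on.simps hderiv.simps)
    qed simp
    show ?thesis
      using 1 2 by (simp add: sum.distrib algebra_simps del: hderiv.simps)
  qed
  ultimately show ?case
    by (simp only: expand)
qed

section \<open>Derivatives of Taylor polynomials\<close>

text \<open>The j-th term yields the coefficient j/j! = 1/(j-1)! and puts w at the head of the list.
  The sum shifts by one, and symmetry moves w to the end of the list, where it is the innermost
  derivative.\<close>

lemma has_derivative_taylor:
  fixes f :: "'a::euclidean_space \<Rightarrow> real"
  assumes f: "Ck_on p UNIV f" and "1 \<le> p"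
  shows "(taylor p f has_derivative
           (\<lambda>w. taylor (p - 1) (\<lambda>y. frechet_derivative f (at y) w) v)) (at v)"
proof -
  obtain n where n: "p = Suc n"
    using \<open>1 \<le> p\<close> by (cases p) auto
  have "((\<lambda>v. hderiv f (replicate j v) 0) has_derivative
           (\<lambda>w. real j * hderiv f (w # replicate (j - 1) v) 0)) (at v)" if "j \<le> p" for j
    using has_derivative_hderiv_replicate[of j "[]" f 0 v] Ck_on_le[OF f that] by simp
  then have "((\<lambda>v. \<Sum>j\<le>p. (1 / fact j) *\<^sub>R hderiv f (replicate j v) 0) has_derivative
      (\<lambda>w. \<Sum>j\<le>p. (1 / fact j) *\<^sub>R (real j * hderiv f (w # replicate (j - 1) v) 0))) (at v)"
    by (intro has_derivative_sum has_derivative_scaleR_right) auto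
  moreover have "(\<Sum>j\<le>p. (1 / fact j) *\<^sub>R (real j * hderiv f (w # replicate (j - 1) v) 0))
      = taylor (p - 1) (\<lambda>y. frechet_derivative f (at y) w) v" for w
  proof -
    have summand: "(1 / fact (Suc j)) *\<^sub>R (real (Suc j) * hderiv f (w # replicate (Suc j - 1) v) 0)
        = (1 / fact j) *\<^sub>R hderiv (hderiv f [w]) (replicate j v) 0" if "j \<le> n" for j
    proof -
      have "hderiv f (replicate j v @ [w]) = hderiv f (w # replicate j v)"
        using hderiv_move_front[of "replicate j v" "[]" f w] Ck_on_le[OF f, of "Suc j"] that n
        by (simp del: Ck_on.simps hderiv.simps)
      moreover have "1 / fact (Suc j) * real (Suc j) = (1 / fact j :: real)"
        by (simp add: fact_Suc del: of_nat_Suc)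
      ultimately show ?thesis
        by (simp add: hderiv_append mult.assoc[symmetric]
              del: hderiv.simps fact_Suc of_nat_Suc)
    qed
    show ?thesis
      unfolding n sum.atMost_Suc_shift using summand
      by (simp add: taylor_def del: hderiv.simps replicate.simps fact_Suc of_nat_Suc) simp
  qed
  ultimately show ?thesis
    by (simp add: taylor_def[abs_def])
qed

lemma taylor_zero:
  fixes f :: "'a::euclidean_space \<Rightarrow> real"
  assumes f: "Ck_on p UNIV f"
  shows "taylor p f 0 = f 0"
proof -
  have "hderiv f (replicate (Suc j) 0) 0 = 0" if "Suc j \<le> p" for j
    using hderiv_Basis_expansion[of "replicate j 0" f 0 0] Ck_on_le[OF f that]
    by (simp del: hderiv.simps Ck_on.simps)
  then have "(\<Sum>j\<in>{..p} - {0}. (1 / fact j) *\<^sub>R hderiv f (replicate j 0) 0) = 0"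
    by (intro sum.neutral ballI) (metis DiffE atMost_iff not0_implies_Suc scaleR_zero_right singletonI)
  then show ?thesis
    unfolding taylor_def by (subst sum.remove[of _ 0]) auto
qed

text \<open>Semidefinite forms are covered because \<open>sigma_min_bound\<close> uses a degenerate
  one. If B w w = 0, the quadratic in t is affine, and the chosen t would give it the value -1
  unless B u w = 0.\<close>

lemma psd_Cauchy_Schwarz:
  fixes B :: "'e::real_vector \<Rightarrow> 'e \<Rightarrow> real"
  assumes "bilinear B" and sym: "\<And>u w. B u w = B w u" and psd: "\<And>u. 0 \<le> B u u"
  shows "(B u w)\<^sup>2 \<le> B u u * B w w"
proof -
  have quad: "0 \<le> B u u + 2 * t * B u w + t\<^sup>2 * B w w" for t
  proof -
    have "B (u + t *\<^sub>R w) (u + t *\<^sub>R w) = B u u + 2 * t * B u w + t\<^sup>2 * B w w"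
      using assms(1) sym[of w u]
      by (simp add: bilinear_ladd bilinear_radd bilinear_lmul bilinear_rmul power2_eq_square algebra_simps)
    with psd show ?thesis by metis
  qed
  show ?thesis
  proof (cases "B w w = 0")
    case True
    have "B u w = 0"
    proof (rule ccontr)
      assume "B u w \<noteq> 0"
      then show False
        using quad[of "- (B u u + 1) / (2 * B u w)"] True by (simp add: field_simps)
    qed
    then show ?thesis by (simp add: True)
  next
    case False
    then have "0 < B w w" using psd[of w] by simp
    then show ?thesis
      using quad[of "- B u w / B w w"] by (simp add: power2_eq_square field_simps)
  qed
qed

section \<open>Norms of covectors and singular values\<close>

context
  fixes A :: "('m::{t2_space,second_countable_topology}, 'e::euclidean_space) chart set"
    and g :: "'m \<Rightarrow> 'e \<Rightarrow> 'e \<Rightarrow> real"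
  assumes metric: "riemannian_metric A g"
begin

lemma metric_bilinear: "bilinear (g x)"
  and metric_sym: "g x u w = g x w u"
  and metric_pos: "u \<noteq> 0 \<Longrightarrow> 0 < g x u u"
  using metric by (auto simp: riemannian_metric_def)

lemma metric_linear: "linear (g x u)"
  using metric_bilinear[of x] by (simp add: bilinear_def)

lemma metric_zero: "g x 0 u = 0" "g x u 0 = 0"
  using metric_bilinear[of x] by (simp_all add: bilinear_lzero bilinear_rzero)

lemma metric_nonneg: "0 \<le> g x u u"
  by (cases "u = 0") (simp_all add: metric_zero metric_pos less_imp_le)

lemma rnorm_nonneg: "0 \<le> rnorm g x u"
  by (simp add: rnorm_def metric_nonneg)

lemma rnorm_power2: "(rnorm g x u)\<^sup>2 = g x u u"
  by (simp add: rnorm_def metric_nonneg)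

lemma rnorm_zero: "rnorm g x 0 = 0"
  by (simp add: rnorm_def metric_zero)

lemma rnorm_pos: "u \<noteq> 0 \<Longrightarrow> 0 < rnorm g x u"
  by (simp add: rnorm_def metric_pos)

lemma rnorm_scaleR: "rnorm g x (c *\<^sub>R u) = \<bar>c\<bar> * rnorm g x u"
  using metric_bilinear[of x]
  by (simp add: rnorm_def bilinear_lmul bilinear_rmul real_sqrt_mult mult.assoc[symmetric])

lemma rnorm_Cauchy_Schwarz: "\<bar>g x u w\<bar> \<le> rnorm g x u * rnorm g x w"
proof -
  have "(g x u w)\<^sup>2 \<le> (rnorm g x u * rnorm g x w)\<^sup>2"
    using psd_Cauchy_Schwarz[OF metric_bilinear metric_sym metric_nonneg]
    by (simp add: power_mult_distrib rnorm_power2)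
  then show ?thesis
    by (simp add: abs_le_square_iff[symmetric] rnorm_nonneg)
qed

text \<open>Keeps the SUP in \<open>covector_norm\<close> away from the empty set.\<close>

lemma unit_rnorm_ex: "\<exists>w. rnorm g x w = 1"
proof -
  obtain b :: 'e where "b \<in> Basis" using nonempty_Basis by blast
  then have "0 < rnorm g x b" by (intro rnorm_pos) auto
  then have "rnorm g x ((1 / rnorm g x b) *\<^sub>R b) = 1"
    by (simp add: rnorm_scaleR)
  then show ?thesis ..
qed

text \<open>The vector T u represents \<open>g x u\<close> in the standard inner product. Positive
  definiteness makes T injective, hence surjective in finite dimension.\<close>

lemma riesz_metric:
  fixes \<omega> :: "'e \<Rightarrow> real"
  assumes "linear \<omega>"
  shows "\<exists>u. \<forall>w. \<omega> w = g x u w"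
proof -
  define T where "T u = (\<Sum>b\<in>Basis. g x u b *\<^sub>R b)" for u
  have T_inner: "T u \<bullet> w = g x u w" for u w
    using linear_Basis_expansion[OF metric_linear, of x u w]
    by (simp add: T_def inner_sum_left inner_commute[of w] mult.commute)
  have "linear T"
    unfolding T_def using metric_bilinear[of x]
    by (intro linearI)
       (simp_all add: bilinear_ladd bilinear_lmul scaleR_add_left sum.distrib scaleR_sum_right)
  moreover have "inj T"
  proof -
    have "u = 0" if "T u = 0" for u
      using T_inner[of u u] that metric_pos[of u x] by fastforce
    then show ?thesis
      using linear_injective_0[OF \<open>linear T\<close>] by blast
  qed
  ultimately have "surj T"
    by (rule linear_injective_imp_surjective) (rule refl)
  then obtain u where "T u = (\<Sum>b\<in>Basis. \<omega> b *\<^sub>R b)" by (metis surjD)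
  then have "\<omega> w = g x u w" for w
    using linear_Basis_expansion[OF assms, of w] T_inner[of u w]
    by (simp add: inner_sum_left inner_commute[of w] mult.commute)
  then show ?thesis by blast
qed

lemma covector_norm_metric: "covector_norm g x (g x u) = rnorm g x u"
  unfolding covector_norm_def
proof (rule cSup_eq_maximum)
  show "rnorm g x u \<in> (\<lambda>w. \<bar>g x u w\<bar>) ` {w. rnorm g x w = 1}"
  proof (cases "u = 0")
    case True
    then show ?thesis using unit_rnorm_ex[of x] by (auto simp: rnorm_zero metric_zero)
  next
    case False
    then have pos: "0 < rnorm g x u" by (rule rnorm_pos)
    then have "rnorm g x ((1 / rnorm g x u) *\<^sub>R u) = 1"
      by (simp add: rnorm_scaleR)
    moreover have "g x u ((1 / rnorm g x u) *\<^sub>R u) = rnorm g x u"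
      using metric_bilinear[of x] pos rnorm_power2[of x u]
      by (simp add: bilinear_rmul power2_eq_square[symmetric] field_simps)
    ultimately show ?thesis
      using pos by (intro image_eqI[where x = "(1 / rnorm g x u) *\<^sub>R u"]) auto
  qed
  show "y \<le> rnorm g x u" if "y \<in> (\<lambda>w. \<bar>g x u w\<bar>) ` {w. rnorm g x w = 1}" for y
  proof -
    obtain w where "rnorm g x w = 1" "y = \<bar>g x u w\<bar>"
      using \<open>y \<in> _\<close> by blast
    then show ?thesis
      using rnorm_Cauchy_Schwarz[of x u w] by simp
  qed
qed

text \<open>A SUP of reals is informative only for a set bounded above. Riesz representation reduces
  \<omega> to \<open>g x u\<close>, where the supremum is an attained maximum.\<close>

lemma covector_norm_bound:
  assumes "linear \<omega>"
  shows "\<bar>\<omega> w\<bar> \<le> covector_norm g x \<omega> * rnorm g x w"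
proof -
  obtain u where "\<omega> = g x u"
    using riesz_metric[OF assms, of x] by blast
  then show ?thesis
    by (simp add: covector_norm_metric rnorm_Cauchy_Schwarz)
qed

lemma covector_norm_leI:
  assumes "\<And>w. \<bar>\<omega> w\<bar> \<le> c * rnorm g x w"
  shows "covector_norm g x \<omega> \<le> c"
  unfolding covector_norm_def
proof (rule cSUP_least)
  show "{w. rnorm g x w = 1} \<noteq> {}" using unit_rnorm_ex by auto
  show "\<bar>\<omega> w\<bar> \<le> c" if "w \<in> {w. rnorm g x w = 1}" for w
    using assms[of w] that by simp
qed

text \<open>Positive definiteness makes the THE in \<open>rgrad\<close> well defined. The stopping
  test becomes a statement about a covector, which can be pulled back along the transport.\<close>

lemma rnorm_rgrad:
  assumes "linear (differential A f x)"
  shows "rnorm g x (rgrad A g f x) = covector_norm g x (differential A f x)"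
proof -
  obtain u where u: "\<And>w. differential A f x w = g x u w"
    using riesz_metric[OF assms] by blast
  have "rgrad A g f x = u"
    unfolding rgrad_def
  proof (rule the_equality)
    show "\<forall>w. g x u w = differential A f x w" by (simp add: u)
    fix u' assume "\<forall>w. g x u' w = differential A f x w"
    then have "g x (u' - u) (u' - u) = 0"
      using metric_bilinear[of x] by (simp add: u bilinear_lsub)
    then show "u' = u"
      using metric_pos[of "u' - u" x] by auto
  qed
  moreover have "differential A f x = g x u" by (simp add: fun_eq_iff u)
  ultimately show ?thesis by (simp add: covector_norm_metric)
qed

lemma rnorm_le_norm: "\<exists>C>0. \<forall>u. rnorm g x u \<le> C * norm u"
proof -
  obtain C where C: "0 < C" "\<And>u w. norm (g x u w) \<le> C * norm u * norm w"
    using bilinear_bounded_pos[OF metric_bilinear[of x]] by blast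
  have "rnorm g x u \<le> sqrt C * norm u" for u
  proof -
    have "g x u u \<le> C * (norm u)\<^sup>2"
      using C(2)[of u u] by (simp add: power2_eq_square mult.assoc)
    then have "sqrt (g x u u) \<le> sqrt (C * (norm u)\<^sup>2)" by simp
    then show ?thesis by (simp add: rnorm_def real_sqrt_mult)
  qed
  with C(1) show ?thesis by (intro exI[of _ "sqrt C"]) auto
qed

text \<open>The norm itself is not differentiable at 0, but its power p + 1 \<ge> 2 has derivative 0
  there; elsewhere the chain rule and Cauchy-Schwarz apply. Only the bound on the derivative matters
  for the model.\<close>

lemma has_derivative_rnorm_power:
  assumes "1 \<le> p"
  shows "\<exists>D. ((\<lambda>u. rnorm g x u ^ (p + 1)) has_derivative D) (at v) \<and>
             (\<forall>w. \<bar>D w\<bar> \<le> real (p + 1) * rnorm g x v ^ p * rnorm g x w)"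
proof (cases "v = 0")
  case True
  obtain C where C: "0 < C" "\<And>u. rnorm g x u \<le> C * norm u"
    using rnorm_le_norm by blast
  have "((\<lambda>u. rnorm g x u ^ (p + 1)) has_derivative (\<lambda>w. 0)) (at 0)"
  proof (rule has_derivativeI_sandwich[of 1])
    show "((\<lambda>u::'e. C ^ (p + 1) * norm u ^ p) \<longlongrightarrow> 0) (at 0)"
      using assms by (auto intro!: tendsto_eq_intros)
    fix u :: 'e assume "u \<noteq> 0" "dist u 0 < 1"
    have "rnorm g x u ^ (p + 1) \<le> (C * norm u) ^ (p + 1)"
      using C(2) rnorm_nonneg by (intro power_mono)
    also have "\<dots> = C ^ (p + 1) * norm u ^ p * norm u"
      by (simp add: power_mult_distrib)
    finally show "norm (rnorm g x u ^ (p + 1) - rnorm g x 0 ^ (p + 1) - 0) / norm (u - 0)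
        \<le> C ^ (p + 1) * norm u ^ p"
      using \<open>u \<noteq> 0\<close> rnorm_nonneg[of x u] by (simp add: rnorm_zero field_simps)
  qed auto
  with True show ?thesis
    by (intro exI[of _ "\<lambda>w. 0"]) (simp add: rnorm_nonneg)
next
  case False
  have n: "0 < rnorm g x v" using False by (rule rnorm_pos)
  have "((\<lambda>u. g x u u) has_derivative (\<lambda>w. g x v w + g x w v)) (at v)"
    using metric_bilinear[of x]
    by (intro bounded_bilinear.FDERIV has_derivative_ident) (simp add: bilinear_conv_bounded_bilinear)
  moreover have "(\<lambda>w. g x v w + g x w v) = (\<lambda>w. 2 * g x v w)"
    by (rule ext) (metis metric_sym mult_2)
  ultimately have "((\<lambda>u. g x u u) has_derivative (\<lambda>w. 2 * g x v w)) (at v)"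
    by simp
  from DERIV_compose_FDERIV[where f = sqrt and g = "\<lambda>u. g x u u",
      OF DERIV_real_sqrt[OF metric_pos[OF False]] this]
  have "(rnorm g x has_derivative (\<lambda>w. g x v w / rnorm g x v)) (at v)"
    unfolding rnorm_def[abs_def]
    by (rule has_derivative_eq_rhs) (simp add: fun_eq_iff field_simps)
  note D = has_derivative_power[OF this, of "p + 1", unfolded diff_add_inverse2]
  have "((\<lambda>u. rnorm g x u ^ (p + 1)) has_derivative
      (\<lambda>w. real (p + 1) * (g x v w / rnorm g x v) * rnorm g x v ^ p)) (at v)"
    by (rule has_derivative_eq_rhs[OF D]) (simp add: fun_eq_iff)
  moreover have "\<bar>real (p + 1) * (g x v w / rnorm g x v) * rnorm g x v ^ p\<bar>
      \<le> real (p + 1) * rnorm g x v ^ p * rnorm g x w" for w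
  proof -
    have "\<bar>g x v w / rnorm g x v\<bar> \<le> rnorm g x w"
      using rnorm_Cauchy_Schwarz[of x v w] n by (simp add: field_simps)
    then have "real (p + 1) * rnorm g x v ^ p * \<bar>g x v w / rnorm g x v\<bar>
        \<le> real (p + 1) * rnorm g x v ^ p * rnorm g x w"
      using n by (intro mult_left_mono) auto
    then show ?thesis
      using n by (simp add: abs_mult mult.commute mult.left_commute)
  qed
  ultimately show ?thesis by blast
qed

text \<open>The minimum of \<open>\<parallel>T w\<parallel> / \<parallel>w\<parallel>\<close> is attained, and by Cauchy--Schwarz for the positive
  semidefinite form \<open>\<langle>T u, T w\<rangle> - m \<langle>u, w\<rangle>\<close> a minimiser is an eigenvector of \<open>T\<^sup>* T\<close>. So the
  set of singular values has a least element and \<open>sigma_min\<close> is not a junk value.\<close>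

lemma sigma_min_bound:
  fixes T :: "'e \<Rightarrow> 'e"
  assumes T: "linear T" and b: "b \<le> sigma_min (g x) (g y) T"
  shows "b * rnorm g x w \<le> rnorm g y (T w)"
proof -
  define Q where "Q u w = g y (T u) (T w)" for u w
  have bilQ: "bilinear Q"
    unfolding Q_def bilinear_def using T metric_bilinear[of y]
    by (auto intro!: linearI simp: linear_add linear_scale bilinear_ladd bilinear_lmul
        bilinear_radd bilinear_rmul)
  have cont: "continuous_on (sphere 0 1) (\<lambda>w. h w w)" if "bilinear h" for h :: "'e \<Rightarrow> 'e \<Rightarrow> real"
    using that by (intro bilinear_continuous_on_compose[OF continuous_on_id continuous_on_id]) auto
  have ne: "sphere (0::'e) 1 \<noteq> {}"
    by simp
  have pos: "0 < g x w w" if "w \<in> sphere 0 1" for w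
    using that by (intro metric_pos) auto
  have "continuous_on (sphere 0 1) (\<lambda>w. Q w w / g x w w)"
    using pos by (intro continuous_on_divide cont bilQ metric_bilinear) force
  from continuous_attains_inf[OF compact_sphere ne this]
  obtain w0 where w0: "w0 \<in> sphere 0 1"
    "\<And>w. w \<in> sphere 0 1 \<Longrightarrow> Q w0 w0 / g x w0 w0 \<le> Q w w / g x w w" by blast
  define m where "m = Q w0 w0 / g x w0 w0"
  have m0: "0 \<le> m"
    using pos[OF w0(1)] by (simp add: m_def Q_def metric_nonneg)
  \<comment> \<open>The quotient is homogeneous of degree zero, so its minimum over the Euclidean
    unit sphere is a bound for all w.\<close>
  have min: "m * g x w w \<le> Q w w" for w
  proof (cases "w = 0")
    case True
    then show ?thesis using bilQ by (simp add: metric_zero bilinear_lzero)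
  next
    case False
    have 1: "(1 / norm w) *\<^sub>R w \<in> sphere 0 1" using False by simp
    have "m * g x ((1 / norm w) *\<^sub>R w) ((1 / norm w) *\<^sub>R w) \<le> Q ((1 / norm w) *\<^sub>R w) ((1 / norm w) *\<^sub>R w)"
      using w0(2)[OF 1] pos[OF 1] by (simp add: m_def pos_le_divide_eq)
    then have "m * g x w w * (1 / norm w)\<^sup>2 \<le> Q w w * (1 / norm w)\<^sup>2"
      using bilQ metric_bilinear[of x]
      by (simp add: bilinear_lmul bilinear_rmul power2_eq_square algebra_simps)
    then show ?thesis
      using False by (simp add: mult_le_cancel_right)
  qed
  define B where "B u w = Q u w - m * g x u w" for u w
  have "bilinear B"
    unfolding B_def bilinear_def using bilQ metric_bilinear[of x]
    by (auto intro!: linearI simp: bilinear_ladd bilinear_lmul bilinear_radd bilinear_rmul algebra_simps)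
  moreover have "B u w = B w u" for u w
    by (simp add: B_def Q_def metric_sym[of _ u] metric_sym[of _ "T u"])
  moreover have "0 \<le> B u u" for u
    using min by (simp add: B_def)
  ultimately have CS: "(B w0 z)\<^sup>2 \<le> B w0 w0 * B z z" for z
    by (rule psd_Cauchy_Schwarz)
  have "B w0 w0 = 0"
    using pos[OF w0(1)] by (simp add: B_def m_def)
  then have "B w0 z = 0" for z
    using CS[of z] by simp
  then have sv: "singular_value (g x) (g y) T (sqrt m)"
    unfolding singular_value_def using m0 w0(1)
    by (auto simp: B_def Q_def intro!: exI[of _ w0])
  have "sqrt m \<le> s" if "singular_value (g x) (g y) T s" for s
  proof -
    obtain w where w: "0 \<le> s" "w \<noteq> 0" "Q w w = s\<^sup>2 * g x w w"
      using \<open>singular_value (g x) (g y) T s\<close> by (auto simp: singular_value_def Q_def)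
    then have "m \<le> s\<^sup>2"
      using min[of w] metric_pos[of w x] by (simp add: mult_le_cancel_right)
    then show ?thesis
      using w(1) by (simp add: real_le_lsqrt)
  qed
  with sv have "sigma_min (g x) (g y) T = sqrt m"
    unfolding sigma_min_def by (rule Least_equality)
  with b have "b * rnorm g x w \<le> sqrt m * rnorm g x w"
    by (intro mult_right_mono rnorm_nonneg) simp
  also have "\<dots> = sqrt (m * g x w w)"
    by (simp add: rnorm_def real_sqrt_mult)
  also have "\<dots> \<le> rnorm g y (T w)"
    using min[of w] by (simp add: rnorm_def Q_def)
  finally show ?thesis .
qed

text \<open>Since b > 0, T is injective and hence onto: every u at y is T w with b |w| \<le> |u|.
  This is how control of a pulled-back covector at x becomes control of the gradient at the trial
  point y.\<close>

lemma covector_norm_pullback: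
  assumes T: "linear T" and b: "0 < b" "b \<le> sigma_min (g x) (g y) T" and "linear \<omega>"
  shows "b * covector_norm g y \<omega> \<le> covector_norm g x (\<lambda>w. \<omega> (T w))"
proof -
  have low: "b * rnorm g x w \<le> rnorm g y (T w)" for w
    using sigma_min_bound[OF T b(2)] .
  have "w = 0" if "T w = 0" for w
  proof (rule ccontr)
    assume "w \<noteq> 0"
    then have "0 < b * rnorm g x w" using b(1) rnorm_pos by simp
    then show False using low[of w] that by (simp add: rnorm_zero)
  qed
  then have "surj T"
    using linear_injective_imp_surjective[OF T] linear_injective_0[OF T] by blast
  have lin: "linear (\<lambda>w. \<omega> (T w))"
    using linear_compose[OF T \<open>linear \<omega>\<close>] by (simp add: o_def)
  define N where "N = covector_norm g x (\<lambda>w. \<omega> (T w))"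
  have bound: "\<bar>\<omega> (T w)\<bar> \<le> N * rnorm g x w" for w
    using covector_norm_bound[OF lin] by (simp add: N_def)
  have N: "0 \<le> N"
    using unit_rnorm_ex[of x] bound by (metis abs_ge_zero mult.right_neutral order_trans)
  have "covector_norm g y \<omega> \<le> N / b"
  proof (rule covector_norm_leI)
    fix u
    obtain w where w: "u = T w" using \<open>surj T\<close> by (metis surjD)
    have "b * \<bar>\<omega> u\<bar> \<le> N * (b * rnorm g x w)"
      using bound[of w] b(1) by (simp add: w)
    also have "\<dots> \<le> N * rnorm g y u"
      using low[of w] N by (simp add: w mult_left_mono)
    finally show "\<bar>\<omega> u\<bar> \<le> N / b * rnorm g y u"
      using b(1) by (simp add: field_simps)
  qed
  then show ?thesis
    using b(1) by (simp add: N_def field_simps)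
qed

end


section \<open>Pullbacks along a retraction\<close>

lemma chart_at_mem:
  assumes "smooth_atlas A"
  shows "chart_at A x \<in> A" "x \<in> fst (chart_at A x)"
proof -
  have "\<exists>c. c \<in> A \<and> x \<in> fst c"
    using assms unfolding smooth_atlas_def by (metis UNIV_I UN_iff)
  from someI_ex[OF this] show "chart_at A x \<in> A" "x \<in> fst (chart_at A x)"
    by (simp_all add: chart_at_def)
qed

lemma smooth_atlas_chart:
  assumes "smooth_atlas A" "c \<in> A"
  shows "open (chart_image c)" "inj_on (snd c) (fst c)"
    "y \<in> fst c \<Longrightarrow> chart_inv c (snd c y) = y"
    "z \<in> chart_image c \<Longrightarrow> snd c (chart_inv c z) = z"
proof -
  have hom: "homeomorphism (fst c) (chart_image c) (snd c) (chart_inv c)"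
    using assms by (auto simp: smooth_atlas_def)
  show "open (chart_image c)"
    using assms by (auto simp: smooth_atlas_def)
  show "inj_on (snd c) (fst c)"
    using hom by (metis homeomorphism_apply1 inj_on_inverseI)
  show "y \<in> fst c \<Longrightarrow> chart_inv c (snd c y) = y" "z \<in> chart_image c \<Longrightarrow> snd c (chart_inv c z) = z"
    using homeomorphism_apply1[OF hom] homeomorphism_apply2[OF hom] by auto
qed

text \<open>The preferred chart defines the identification of the fibre with \<open>'e\<close>, and
  its transition to itself is the identity near x.\<close>

lemma tangent_coord_chart_at:
  assumes "smooth_atlas A"
  shows "tangent_coord A (chart_at A x) x v = v"
proof -
  note c = chart_at_mem[OF assms, of x]
  have "frechet_derivative (snd (chart_at A x) \<circ> chart_inv (chart_at A x)) (at (snd (chart_at A x) x))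
      = frechet_derivative (\<lambda>y. y) (at (snd (chart_at A x) x))"
    using smooth_atlas_chart[OF assms c(1)] c(2)
    by (intro frechet_derivative_cong_open[of "chart_image (chart_at A x)"]) auto
  then show ?thesis
    by (simp add: tangent_coord_def)
qed

lemma Ck_on_ident: "Ck_on k S (\<lambda>x. x)"
  by (cases k) (auto simp: Ck_on_const)

text \<open>Smoothness of R is given in bundle charts. In the bundle chart over
  \<open>chart_at A x\<close> the fibre over x is the affine slice (snd c x, w), so U is a slice of
  the open coordinate domain D and R x is smooth on it.\<close>

lemma retraction_local:
  assumes A: "smooth_atlas A" and R: "manifold_retraction A R"
    and d: "d \<in> A" "R x v \<in> fst d"
  obtains U where "open U" "v \<in> U" "\<And>w. w \<in> U \<Longrightarrow> R x w \<in> fst d"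
    "\<And>k. Ck_on k U (\<lambda>w. snd d (R x w))"
proof -
  define c where "c = chart_at A x"
  have c: "c \<in> A" "x \<in> fst c"
    using chart_at_mem[OF A, of x] by (simp_all add: c_def)
  define a where "a = (fst c \<times> (UNIV :: 'b set), \<lambda>(y, u). (snd c y, tangent_coord A c y u))"
  define F where "F = (\<lambda>(y, u). R y u)"
  define D where "D = {y \<in> chart_image a. F (chart_inv a y) \<in> fst d}"
  have a: "a \<in> tangent_atlas A"
    using c(1) by (simp add: a_def tangent_atlas_def)
  have snd_a: "snd a (x, w) = (snd c x, w)" for w
    using tangent_coord_chart_at[OF A, of x] by (simp add: a_def c_def)
  \<comment> \<open>\<open>chart_inv\<close> is a choice of preimage. It is forced here: injectivity
    of \<open>snd c\<close> fixes the base point x, and over x the chart reads off w.\<close>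
  have inv_a: "chart_inv a (snd c x, w) = (x, w)" for w
    unfolding chart_inv_def inv_into_def
  proof (rule some_equality)
    show "(x, w) \<in> fst a \<and> snd a (x, w) = (snd c x, w)"
      using c snd_a by (simp add: a_def)
    fix z assume z: "z \<in> fst a \<and> snd a z = (snd c x, w)"
    then have "fst z \<in> fst c" "snd c (fst z) = snd c x"
      by (auto simp: a_def)
    then have "fst z = x"
      using smooth_atlas_chart(2)[OF A c(1)] c(2) by (auto dest: inj_onD)
    with z snd_a show "z = (x, w)" by (cases z) auto
  qed
  have D: "open D" "\<And>k. Ck_on k D (snd d \<circ> F \<circ> chart_inv a)"
    using R a d(1)
    by (auto simp: manifold_retraction_def smooth_map_def smooth_on_def Let_def D_def F_def)
  define U where "U = (\<lambda>w. (snd c x, w)) -` D"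
  have U: "open U"
    unfolding U_def by (intro open_vimage D continuous_intros)
  show thesis
  proof
    show "open U" by fact
    have "snd a (x, v) \<in> chart_image a"
      using c by (intro imageI) (simp add: a_def)
    then have "(snd c x, v) \<in> chart_image a"
      by (simp add: snd_a)
    then show "v \<in> U"
      using d(2) by (simp add: U_def D_def inv_a F_def)
    show "R x w \<in> fst d" if "w \<in> U" for w
      using that by (simp add: U_def D_def inv_a F_def)
    fix k
    have "Ck_on k U (\<lambda>w. (snd c x, 0) + (0, w))"
      using U Ck_on_bounded_linear_compose[OF U, of "\<lambda>w. (0, w)" k "\<lambda>w. w"]
      by (intro Ck_on_add Ck_on_const)
         (simp_all add: Ck_on_ident bounded_linear_Pair bounded_linear_zero bounded_linear_ident)
    then have "Ck_on k U (\<lambda>w. (snd c x, w))" by simp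
    from Ck_on_compose[OF U this D(2)]
    show "Ck_on k U (\<lambda>w. snd d (R x w))"
      by (simp add: U_def inv_a F_def)
  qed
qed

lemma Ck_on_pullback:
  assumes A: "smooth_atlas A" and R: "manifold_retraction A R" and f: "Ck_fun p A f"
  shows "Ck_on p UNIV (pullback f R x)"
proof (rule Ck_on_locally)
  fix v
  define d where "d = chart_at A (R x v)"
  have d: "d \<in> A" "R x v \<in> fst d"
    using chart_at_mem[OF A] by (simp_all add: d_def)
  obtain U where U: "open U" "v \<in> U" "\<And>w. w \<in> U \<Longrightarrow> R x w \<in> fst d"
    "\<And>k. Ck_on k U (\<lambda>w. snd d (R x w))"
    using retraction_local[OF A R d] by blast
  have "Ck_on p (chart_image d) (f \<circ> chart_inv d)"
    using f d(1) by (simp add: Ck_fun_def)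
  from Ck_on_compose[OF U(1,4) this imageI[OF U(3)]]
  have "Ck_on p U (\<lambda>w. (f \<circ> chart_inv d) (snd d (R x w)))" .
  then have "Ck_on p U (pullback f R x)"
    by (rule Ck_on_cong[OF U(1), rotated])
       (simp add: pullback_def smooth_atlas_chart(3)[OF A d(1) U(3)])
  with U show "\<exists>U. open U \<and> v \<in> U \<and> Ck_on p U (pullback f R x)" by blast
qed

text \<open>The retraction has identity derivative at 0, so the chain rule leaves the differential
  of f. With \<open>rnorm_rgrad\<close> this expresses gradients through derivatives of pullbacks at
  0.\<close>

lemma has_derivative_pullback_zero:
  assumes A: "smooth_atlas A" and R: "manifold_retraction A R"
    and f: "Ck_fun p A f" and "1 \<le> p"
  shows "linear (differential A f x)"
    and "frechet_derivative (pullback f R x) (at 0) = differential A f x"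
proof -
  define c where "c = chart_at A x"
  have c: "c \<in> A" "x \<in> fst c"
    using chart_at_mem[OF A, of x] by (simp_all add: c_def)
  have Rx: "R x 0 = x" "((\<lambda>v. snd c (R x v)) has_derivative (\<lambda>v. v)) (at 0)"
    using R by (auto simp: manifold_retraction_def c_def)
  have diff: "(f \<circ> chart_inv c) differentiable (at (snd c x))"
    using f c \<open>1 \<le> p\<close> by (intro Ck_on_imp_differentiable) (auto simp: Ck_fun_def)
  have eq: "differential A f x = frechet_derivative (f \<circ> chart_inv c) (at (snd c x))"
    by (simp add: fun_eq_iff differential_def c_def)
  show "linear (differential A f x)"
    unfolding eq using diff by (rule linear_frechet_derivative)
  have "R x 0 \<in> fst c" by (simp add: Rx c)
  then obtain U where U: "open U" "0 \<in> U" "\<And>w. w \<in> U \<Longrightarrow> R x w \<in> fst c"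
    using retraction_local[OF A R c(1)] by metis
  have "((\<lambda>v. (f \<circ> chart_inv c) (snd c (R x v))) has_derivative differential A f x) (at 0)"
    using has_derivative_compose[OF Rx(2), of "f \<circ> chart_inv c"] has_derivative_frechet[OF diff]
    by (simp add: Rx(1) eq)
  then have "(pullback f R x has_derivative differential A f x) (at 0)"
    using U smooth_atlas_chart(3)[OF A c(1)]
    by (elim has_derivative_transform_within_open) (auto simp: pullback_def)
  then show "frechet_derivative (pullback f R x) (at 0) = differential A f x"
    by (rule frechet_derivative_eqI)
qed

section \<open>The iteration\<close>

locale rar_iteration =
  fixes A :: "('m::{t2_space,second_countable_topology}, 'e::euclidean_space) chart set"
    and g :: "'m \<Rightarrow> 'e \<Rightarrow> 'e \<Rightarrow> real"
    and R :: "'m \<Rightarrow> 'e \<Rightarrow> 'm"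
    and VT :: "'m \<Rightarrow> 'e \<Rightarrow> 'e \<Rightarrow> 'e"
    and f :: "'m \<Rightarrow> real"
    and p :: nat
    and P :: rar_params
    and x0 :: 'm
    and x :: "nat \<Rightarrow> 'm"
    and \<alpha> :: "nat \<Rightarrow> real"
    and v :: "nat \<Rightarrow> 'e"
    and K :: enat
    and L r b \<epsilon> L0 \<epsilon>0 :: real
  assumes p: "1 \<le> p"
    and atlas: "smooth_atlas A"
    and metric: "riemannian_metric A g"
    and retraction: "manifold_retraction A R"
    and transport: "vector_transport A R VT"
    and Ck: "Ck_fun p A f"
    and bdd: "bdd_below (range f)"
    and params: "valid_params P"
    and L: "0 < L" and r: "0 < r" and b: "0 < b"
    and L0: "0 < L0" "L0 \<le> L"
    and \<epsilon>: "0 < \<epsilon>" and \<epsilon>0: "0 < \<epsilon>0" "\<epsilon> \<le> \<epsilon>0"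
    and run: "rar_run p P \<epsilon> A g R f x0 x \<alpha> v K"
    and major: "majorization_smooth L p g R f (rar_increments x v K)"
    and tsmooth: "transport_smooth L p g R VT f (rar_increments x v K)"
    and short: "short_step_lower_bound r b g R VT (rar_increments x v K)"
begin

abbreviation "\<rho> i \<equiv> rar_ratio p R f (x i) (v i)"
abbreviation "len i \<equiv> rnorm g (x i) (v i)"
abbreviation "grad_norm y \<equiv> rnorm g y (rgrad A g f y)"

lemma valid:
  "0 < theta P" "0 < alpha_min P" "alpha_min P \<le> alpha_init P" "0 < alpha_init P"
  "0 < eta1 P" "eta1 P \<le> eta2 P" "eta2 P < 1"
  "0 < gamma1 P" "gamma1 P < 1" "1 < gamma2 P" "gamma2 P < gamma3 P"
  using params by (auto simp: valid_params_def)

lemma Ck_pullback: "Ck_on p UNIV (pullback f R y)"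
  using Ck_on_pullback[OF atlas retraction Ck] .

lemma linear_pullback_deriv: "linear (frechet_derivative (pullback f R y) (at u))"
  using Ck_on_imp_differentiable[OF Ck_pullback p] by (intro linear_frechet_derivative) simp

lemma grad_norm_eq:
  "grad_norm y = covector_norm g y (frechet_derivative (pullback f R y) (at 0))"
  using has_derivative_pullback_zero[OF atlas retraction Ck p] rnorm_rgrad[OF metric] by simp

lemma increment_mem: "enat i < K \<Longrightarrow> (x i, v i) \<in> rar_increments x v K"
  by (auto simp: rar_increments_def)

lemma run_init: "x 0 = x0" "\<alpha> 0 = alpha_init P"
  using run by (auto simp: rar_run_def)

lemma not_stationary: "enat i < K \<Longrightarrow> \<epsilon> < grad_norm (x i)"
  using run by (auto simp: rar_run_def not_le)

lemma run_step:
  assumes "enat i < K"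
  shows "rar_model p g R f (\<alpha> i) (x i) (v i) \<le> rar_model p g R f (\<alpha> i) (x i) 0"
    and "covector_norm g (x i) (frechet_derivative (rar_model p g R f (\<alpha> i) (x i)) (at (v i)))
           \<le> theta P * len i ^ p"
    and "x (Suc i) = (if eta1 P \<le> \<rho> i then R (x i) (v i) else x i)"
    and "eta2 P \<le> \<rho> i \<Longrightarrow> \<alpha> (Suc i) \<in> {max (alpha_min P) (gamma1 P * \<alpha> i)..\<alpha> i}"
    and "\<not> eta2 P \<le> \<rho> i \<Longrightarrow> eta1 P \<le> \<rho> i \<Longrightarrow> \<alpha> (Suc i) \<in> {\<alpha> i..gamma2 P * \<alpha> i}"
    and "\<not> eta1 P \<le> \<rho> i \<Longrightarrow> \<alpha> (Suc i) \<in> {gamma2 P * \<alpha> i..gamma3 P * \<alpha> i}"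
proof -
  have s: "rar_step p P g R f (x i) (\<alpha> i) (v i) (x (Suc i)) (\<alpha> (Suc i))"
    using run assms by (auto simp: rar_run_def)
  show "rar_model p g R f (\<alpha> i) (x i) (v i) \<le> rar_model p g R f (\<alpha> i) (x i) 0"
    "covector_norm g (x i) (frechet_derivative (rar_model p g R f (\<alpha> i) (x i)) (at (v i)))
           \<le> theta P * len i ^ p"
    "x (Suc i) = (if eta1 P \<le> \<rho> i then R (x i) (v i) else x i)"
    using s unfolding rar_step_def Let_def by blast+
  have c: "if eta2 P \<le> \<rho> i then \<alpha> (Suc i) \<in> {max (alpha_min P) (gamma1 P * \<alpha> i)..\<alpha> i}
         else if eta1 P \<le> \<rho> i then \<alpha> (Suc i) \<in> {\<alpha> i..gamma2 P * \<alpha> i}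
         else \<alpha> (Suc i) \<in> {gamma2 P * \<alpha> i..gamma3 P * \<alpha> i}"
    using s unfolding rar_step_def Let_def by blast
  show "eta2 P \<le> \<rho> i \<Longrightarrow> \<alpha> (Suc i) \<in> {max (alpha_min P) (gamma1 P * \<alpha> i)..\<alpha> i}"
    using c by (simp only: if_True)
  show "\<not> eta2 P \<le> \<rho> i \<Longrightarrow> eta1 P \<le> \<rho> i \<Longrightarrow> \<alpha> (Suc i) \<in> {\<alpha> i..gamma2 P * \<alpha> i}"
    using c by (simp only: if_True if_False)
  show "\<not> eta1 P \<le> \<rho> i \<Longrightarrow> \<alpha> (Suc i) \<in> {gamma2 P * \<alpha> i..gamma3 P * \<alpha> i}"
    using c valid(6) by (simp split: if_splits)
qed

section \<open>Lower bound and growth of the weights\<close>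

lemma alpha_ge: "enat i \<le> K \<Longrightarrow> alpha_min P \<le> \<alpha> i"
proof (induction i)
  case 0
  then show ?case using run_init valid by simp
next
  case (Suc i)
  then have i: "enat i < K" by (simp add: Suc_ile_eq)
  with Suc.IH have IH: "alpha_min P \<le> \<alpha> i" by simp
  then have "\<alpha> i \<le> gamma2 P * \<alpha> i"
    using valid by simp
  with run_step(4-6)[OF i] IH show ?case
    by (cases "eta2 P \<le> \<rho> i"; cases "eta1 P \<le> \<rho> i") auto
qed

lemma alpha_pos: "enat i \<le> K \<Longrightarrow> 0 < \<alpha> i"
  using alpha_ge valid(2) by fastforce

text \<open>Steps with \<open>eta1 P\<close> \<le> \<rho> < \<open>eta2 P\<close> do not shrink the
  weight; charging them the factor \<open>gamma1 P\<close> < 1 as well lets the count distinguish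
  only successes and rejections.\<close>

lemma alpha_growth:
  assumes "enat i < K"
  shows "(if eta1 P \<le> \<rho> i then gamma1 P else gamma2 P) * \<alpha> i \<le> \<alpha> (Suc i)"
proof -
  have "0 < \<alpha> i" using assms by (simp add: alpha_pos)
  then have "gamma1 P * \<alpha> i \<le> \<alpha> i" using valid(9) by simp
  with run_step(4-6)[OF assms] show ?thesis
    by (cases "eta2 P \<le> \<rho> i"; cases "eta1 P \<le> \<rho> i") auto
qed

section \<open>The derivative of the model at the increment\<close>

abbreviation "DT i w \<equiv>
  taylor (p - 1) (\<lambda>y. frechet_derivative (pullback f R (x i)) (at y) w) (v i)"

lemma linear_DT: "linear (DT i)"
  using has_derivative_linear[OF has_derivative_taylor[OF Ck_pullback p]] .

text \<open>The gradient test bounds the sum of DT and the derivative of the regularization term.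
  The latter is at most \<alpha> |v|^p because its factor p + 1 cancels, and the triangle inequality
  isolates DT.\<close>

lemma DT_bound:
  assumes "enat i < K"
  shows "\<bar>DT i w\<bar> \<le> (theta P + \<alpha> i) * len i ^ p * rnorm g (x i) w"
proof -
  have a: "0 < \<alpha> i" using alpha_pos assms by simp
  obtain D where D: "((\<lambda>u. rnorm g (x i) u ^ (p + 1)) has_derivative D) (at (v i))"
    "\<And>w. \<bar>D w\<bar> \<le> real (p + 1) * len i ^ p * rnorm g (x i) w"
    using has_derivative_rnorm_power[OF metric p] by blast
  have "(rar_model p g R f (\<alpha> i) (x i) has_derivative
          (\<lambda>w. DT i w + \<alpha> i / real (p + 1) * D w)) (at (v i))"
    unfolding rar_model_def[abs_def]
    by (intro has_derivative_add has_derivative_mult_right D(1) has_derivative_taylor[OF Ck_pullback p])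
  then have "linear (\<lambda>w. DT i w + \<alpha> i / real (p + 1) * D w)"
    and "frechet_derivative (rar_model p g R f (\<alpha> i) (x i)) (at (v i))
           = (\<lambda>w. DT i w + \<alpha> i / real (p + 1) * D w)"
    by (auto dest: has_derivative_linear frechet_derivative_eqI)
  with covector_norm_bound[OF metric, where x = "x i" and w = w] run_step(2)[OF assms]
  have "\<bar>DT i w + \<alpha> i / real (p + 1) * D w\<bar> \<le> theta P * len i ^ p * rnorm g (x i) w"
    using rnorm_nonneg[OF metric] by (metis (no_types, lifting) mult_right_mono order_trans)
  moreover have "\<bar>\<alpha> i / real (p + 1) * D w\<bar> \<le> \<alpha> i * len i ^ p * rnorm g (x i) w"
  proof -
    have "\<bar>\<alpha> i / real (p + 1) * D w\<bar> = \<alpha> i / real (p + 1) * \<bar>D w\<bar>"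
      using a by (simp add: abs_mult)
    also have "\<dots> \<le> \<alpha> i / real (p + 1) * (real (p + 1) * len i ^ p * rnorm g (x i) w)"
      using a D(2) by (intro mult_left_mono) auto
    finally show ?thesis by simp
  qed
  ultimately show ?thesis
    unfolding distrib_right by linarith
qed

text \<open>At v = 0 the bound on DT is 0, as p \<ge> 1, and DT is the derivative of the pullback at
  0. The gradient would vanish and the run would have stopped.\<close>

lemma increment_nonzero:
  assumes "enat i < K"
  shows "v i \<noteq> 0"
proof
  assume v: "v i = 0"
  have "frechet_derivative (pullback f R (x i)) (at 0) w = 0" for w
  proof -
    obtain n where n: "p = Suc n" using p by (cases p) auto
    have "Ck_on (p - 1) UNIV (\<lambda>y. frechet_derivative (pullback f R (x i)) (at y) w)"
      using Ck_pullback[of "x i"] by (simp add: n)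
    from taylor_zero[OF this] DT_bound[OF assms, of w] show ?thesis
      by (simp add: v n rnorm_zero[OF metric])
  qed
  then have "grad_norm (x i) \<le> 0"
    unfolding grad_norm_eq by (intro covector_norm_leI[OF metric]) simp
  with not_stationary[OF assms] \<epsilon> show False by simp
qed

lemma len_pos: "enat i < K \<Longrightarrow> 0 < len i"
  using increment_nonzero rnorm_pos[OF metric] by blast

section \<open>Predicted and actual decrease\<close>

lemma retraction_zero: "R y 0 = y"
  using retraction by (simp add: manifold_retraction_def)

lemma taylor_decrease:
  assumes "enat i < K"
  shows "\<alpha> i / real (p + 1) * len i ^ (p + 1) \<le> f (x i) - taylor p (pullback f R (x i)) (v i)"
proof -
  have "pullback f R (x i) 0 = f (x i)"
    by (simp add: pullback_def retraction_zero)
  then have "rar_model p g R f (\<alpha> i) (x i) 0 = f (x i)"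
    by (simp add: rar_model_def taylor_zero[OF Ck_pullback] rnorm_zero[OF metric])
  with run_step(1)[OF assms] show ?thesis
    by (simp add: rar_model_def)
qed

text \<open>This is the denominator of \<rho>, so the value of division by zero never
  enters.\<close>

lemma taylor_decrease_pos:
  assumes "enat i < K"
  shows "0 < f (x i) - taylor p (pullback f R (x i)) (v i)"
proof -
  have "0 < \<alpha> i / real (p + 1) * len i ^ (p + 1)"
    using alpha_pos[of i] len_pos[of i] assms by simp
  with taylor_decrease[OF assms] show ?thesis by linarith
qed

text \<open>The predicted decrease d is at least \<alpha>/(p+1) |v|^(p+1), so the majorization error
  L/(p+1) |v|^(p+1) is at most (L/\<alpha>) d.\<close>

lemma ratio_ge:
  assumes i: "enat i < K"
  shows "1 - L / \<alpha> i \<le> \<rho> i"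
proof -
  define d where "d = f (x i) - taylor p (pullback f R (x i)) (v i)"
  have a: "0 < \<alpha> i" using alpha_pos[of i] i by simp
  have d: "0 < d" using taylor_decrease_pos[OF i] by (simp add: d_def)
  have "len i ^ (p + 1) / real (p + 1) \<le> d / \<alpha> i"
    using taylor_decrease[OF i] a by (simp add: d_def pos_le_divide_eq mult.commute)
  then have "L * (len i ^ (p + 1) / real (p + 1)) \<le> L * (d / \<alpha> i)"
    using L by (intro mult_left_mono) auto
  moreover have "f (R (x i) (v i)) \<le> taylor p (pullback f R (x i)) (v i) + L / real (p + 1) * len i ^ (p + 1)"
    using major increment_mem[OF i] by (auto simp: majorization_smooth_def pullback_def)
  moreover have "L * (d / \<alpha> i) = d - d * (1 - L / \<alpha> i)"
    by (simp add: algebra_simps)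
  moreover have "L * (len i ^ (p + 1) / real (p + 1)) = L / real (p + 1) * len i ^ (p + 1)"
    by simp
  ultimately have "d * (1 - L / \<alpha> i) \<le> f (x i) - f (R (x i) (v i))"
    unfolding d_def by linarith
  then show ?thesis
    using d by (simp add: rar_ratio_def d_def[symmetric] pos_le_divide_eq mult.commute)
qed

text \<open>A weight can grow only if \<rho> < \<open>eta2 P\<close>, which by
  \<open>ratio_ge\<close> forces \<alpha> < L/(1 - eta2); one update multiplies it by at most
  \<open>gamma3 P\<close>.\<close>

lemma alpha_le: "enat i \<le> K \<Longrightarrow> \<alpha> i \<le> max (alpha_init P) (gamma3 P * L / (1 - eta2 P))"
proof (induction i)
  case 0
  then show ?case using run_init by simp
next
  case (Suc i)
  then have i: "enat i < K" by (simp add: Suc_ile_eq)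
  have a: "0 < \<alpha> i" using alpha_pos[of i] i by simp
  show ?case
  proof (cases "eta2 P \<le> \<rho> i")
    case True
    then have "\<alpha> (Suc i) \<le> \<alpha> i"
      using run_step(4)[OF i] by simp
    with Suc.IH[OF order_less_imp_le[OF i]] show ?thesis by (rule order_trans[rotated])
  next
    case False
    then have "1 - L / \<alpha> i < eta2 P" using ratio_ge[OF i] by linarith
    then have "\<alpha> i \<le> L / (1 - eta2 P)"
      using a valid(7) by (simp add: field_simps)
    then have "gamma3 P * \<alpha> i \<le> gamma3 P * (L / (1 - eta2 P))"
      using valid by (intro mult_left_mono) auto
    moreover have "\<alpha> (Suc i) \<le> gamma3 P * \<alpha> i"
    proof (cases "eta1 P \<le> \<rho> i")
      case True
      then have "\<alpha> (Suc i) \<le> gamma2 P * \<alpha> i" using run_step(5)[OF i False] by simp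
      also have "\<dots> \<le> gamma3 P * \<alpha> i" using a valid by (intro mult_right_mono) auto
      finally show ?thesis .
    next
      case False
      then show ?thesis using run_step(6)[OF i] by simp
    qed
    ultimately show ?thesis by simp
  qed
qed

lemma success_decrease:
  assumes i: "enat i < K" and "eta1 P \<le> \<rho> i"
  shows "eta1 P * alpha_min P / real (p + 1) * len i ^ (p + 1) \<le> f (x i) - f (x (Suc i))"
proof -
  have "eta1 P * (alpha_min P / real (p + 1) * len i ^ (p + 1))
      \<le> eta1 P * (\<alpha> i / real (p + 1) * len i ^ (p + 1))"
    using alpha_ge[of i] len_pos[OF i] i valid(5)
    by (intro mult_left_mono mult_right_mono divide_right_mono) auto
  also have "\<dots> \<le> eta1 P * (f (x i) - taylor p (pullback f R (x i)) (v i))"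
    using taylor_decrease[OF i] valid(5) by (intro mult_left_mono) auto
  also have "\<dots> \<le> f (x i) - f (x (Suc i))"
    using assms(2) run_step(3)[OF i] taylor_decrease_pos[OF i]
    by (simp add: rar_ratio_def pos_le_divide_eq)
  finally show ?thesis by simp
qed

lemma f_decreasing:
  assumes i: "enat i < K"
  shows "f (x (Suc i)) \<le> f (x i)"
proof (cases "eta1 P \<le> \<rho> i")
  case True
  have "0 \<le> eta1 P * alpha_min P / real (p + 1) * len i ^ (p + 1)"
    using valid len_pos[OF i] by simp
  with success_decrease[OF i True] show ?thesis by linarith
next
  case False
  then show ?thesis using run_step(3)[OF i] by simp
qed

section \<open>Gradient and gain after a successful step\<close>

text \<open>Chosen so that kappa L dominates p/(p+1) L + theta + \<alpha>: the summand 1 takes the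
  first term, the second takes the part of \<alpha> proportional to L, and the third makes theta and
  the initial weight multiples of L through L \<ge> L0.\<close>

definition kappa :: real where
  "kappa = 1 + gamma3 P / (1 - eta2 P) + (theta P + alpha_init P) / L0"

lemma kappa_pos: "0 < kappa"
  unfolding kappa_def using valid L0 by (intro add_pos_pos) auto

lemma short_step:
  assumes i: "enat i < K" and "len i \<le> r"
  shows "b * grad_norm (R (x i) (v i)) \<le> kappa * L * len i ^ p"
proof -
  let ?y = "R (x i) (v i)"
  let ?\<omega> = "frechet_derivative (pullback f R ?y) (at 0)"
  have VT: "linear (VT (x i) (v i))"
    using transport by (simp add: vector_transport_def)
  have "b \<le> sigma_min (g (x i)) (g ?y) (VT (x i) (v i))"
    using short increment_mem[OF i] assms(2) by (auto simp: short_step_lower_bound_def)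
  from covector_norm_pullback[OF metric VT b this linear_pullback_deriv]
  have "b * grad_norm ?y \<le> covector_norm g (x i) (\<lambda>w. ?\<omega> (VT (x i) (v i) w))"
    by (simp add: grad_norm_eq)
  also have "\<dots> \<le> (real p / real (p + 1) * L + theta P + \<alpha> i) * len i ^ p"
  proof (rule covector_norm_leI[OF metric])
    fix w
    have "linear (\<lambda>w. ?\<omega> (VT (x i) (v i) w) - DT i w)"
      using linear_compose_sub[OF linear_compose[OF VT linear_pullback_deriv] linear_DT]
      by (simp add: o_def)
    from covector_norm_bound[OF metric this]
    have "\<bar>?\<omega> (VT (x i) (v i) w) - DT i w\<bar>
        \<le> covector_norm g (x i) (\<lambda>w. ?\<omega> (VT (x i) (v i) w) - DT i w) * rnorm g (x i) w" .
    also have "\<dots> \<le> real p / real (p + 1) * L * len i ^ p * rnorm g (x i) w"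
      using tsmooth increment_mem[OF i]
      by (intro mult_right_mono rnorm_nonneg[OF metric]) (auto simp: transport_smooth_def)
    finally show "\<bar>?\<omega> (VT (x i) (v i) w)\<bar>
        \<le> (real p / real (p + 1) * L + theta P + \<alpha> i) * len i ^ p * rnorm g (x i) w"
      using DT_bound[OF i, of w] by (simp add: algebra_simps)
  qed
  also have "\<dots> \<le> kappa * L * len i ^ p"
  proof (intro mult_right_mono)
    have "real p / real (p + 1) * L \<le> 1 * L"
      using L by (intro mult_right_mono) auto
    moreover have "1 \<le> L / L0" using L0 by simp
    then have "(theta P + alpha_init P) * 1 \<le> (theta P + alpha_init P) * (L / L0)"
      using valid by (intro mult_left_mono) auto
    \<comment> \<open>The maximum in \<open>alpha_le\<close> is weakened to the sum of its
      arguments, which is why kappa is a plain sum.\<close>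
    moreover have "0 \<le> gamma3 P * L / (1 - eta2 P)"
      using valid L by simp
    then have "\<alpha> i \<le> alpha_init P + gamma3 P * L / (1 - eta2 P)"
      using alpha_le[OF order_less_imp_le[OF i]] valid(4) by linarith
    ultimately show "real p / real (p + 1) * L + theta P + \<alpha> i \<le> kappa * L"
      by (simp add: kappa_def add_divide_distrib algebra_simps)
  qed (use len_pos[OF i] in simp)
  finally show ?thesis .
qed

abbreviation "q \<equiv> real (p + 1) / real p"
abbreviation "E \<equiv> (L / \<epsilon>) powr q"

text \<open>The minimum covers two cases: a step longer than r has |v|^(p+1) \<ge> r^(p+1), rescaled
  by (L0/\<epsilon>0)^q \<le> E, and a short step has |v|^(p+1) E \<ge> (b/kappa)^q.\<close>

definition delta :: real where
  "delta = eta1 P * alpha_min P / real (p + 1) *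
             min (r ^ (p + 1) * (L0 / \<epsilon>0) powr q) ((b / kappa) powr q)"

lemma delta_pos: "0 < delta"
  unfolding delta_def using valid r b kappa_pos L0 \<epsilon>0 by simp

lemma E_pos: "0 < E"
  using L \<epsilon> by simp

lemma ratio_bounds: "0 < L0 / \<epsilon>0" "L0 / \<epsilon>0 \<le> L / \<epsilon>"
  using L0 \<epsilon>0 \<epsilon> L by (auto intro!: frac_le)

text \<open>Turns every additive 1 in the counts into a multiple of E.\<close>

lemma E_ge: "1 \<le> (\<epsilon>0 / L0) powr q * E"
proof -
  have "1 powr q \<le> (\<epsilon>0 / L0 * (L / \<epsilon>)) powr q"
    using ratio_bounds L0 \<epsilon>0 \<epsilon> L by (intro powr_mono2) (auto simp: field_simps)
  also have "\<dots> = (\<epsilon>0 / L0) powr q * E"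
    using L0 \<epsilon>0 \<epsilon> L by (intro powr_mult)
  finally show ?thesis by simp
qed

text \<open>This is the origin of the exponent: the gradient is controlled by |v|^p and the decrease
  of f by |v|^(p+1), so the short-step inequality is raised to the power q = (p+1)/p.\<close>

lemma step_gain:
  assumes i: "enat i < K" and succ: "eta1 P \<le> \<rho> i" and ns: "\<epsilon> < grad_norm (x (Suc i))"
  shows "delta \<le> (f (x i) - f (x (Suc i))) * E"
proof -
  define c where "c = eta1 P * alpha_min P / real (p + 1)"
  have c: "0 < c" using valid by (simp add: c_def)
  have n: "0 < len i" using len_pos[OF i] .
  have "min (r ^ (p + 1) * (L0 / \<epsilon>0) powr q) ((b / kappa) powr q) \<le> len i ^ (p + 1) * E"
  proof (cases "len i \<le> r")
    case True
    have "b * \<epsilon> \<le> b * grad_norm (x (Suc i))"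
      using b ns by simp
    also have "\<dots> \<le> kappa * L * len i ^ p"
      using short_step[OF i True] run_step(3)[OF i] succ by simp
    finally have "b / kappa \<le> len i ^ p * (L / \<epsilon>)"
      using kappa_pos \<epsilon> by (simp add: field_simps)
    then have "(b / kappa) powr q \<le> (len i ^ p * (L / \<epsilon>)) powr q"
      using b kappa_pos by (intro powr_mono2) auto
    also have "\<dots> = (len i ^ p) powr q * E"
      using n L \<epsilon> by (intro powr_mult)
    also have "(len i ^ p) powr q = len i ^ (p + 1)"
    proof -
      have "(len i ^ p) powr q = len i powr (real p * q)"
        using n by (simp add: powr_realpow[symmetric] powr_powr)
      also have "real p * q = real (p + 1)" using p by simp
      finally show ?thesis using n by (simp only: powr_realpow)
    qed
    finally show ?thesis by simp
  next
    case False
    then have "r ^ (p + 1) * (L0 / \<epsilon>0) powr q \<le> len i ^ (p + 1) * E"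
      using r n ratio_bounds by (intro mult_mono power_mono powr_mono2) auto
    then show ?thesis by simp
  qed
  then have "c * min (r ^ (p + 1) * (L0 / \<epsilon>0) powr q) ((b / kappa) powr q) \<le> c * (len i ^ (p + 1) * E)"
    using c by (intro mult_left_mono) auto
  then have "delta \<le> (c * len i ^ (p + 1)) * E"
    by (simp add: delta_def c_def mult.assoc)
  also have "\<dots> \<le> (f (x i) - f (x (Suc i))) * E"
    using success_decrease[OF i succ] E_pos by (intro mult_right_mono) (auto simp: c_def)
  finally show ?thesis .
qed

section \<open>Counting steps and oracle calls\<close>

abbreviation "successes n \<equiv> {i \<in> {..<n}. eta1 P \<le> \<rho> i}"
abbreviation "rejections n \<equiv> {i \<in> {..<n}. \<not> eta1 P \<le> \<rho> i}"
abbreviation "gap \<equiv> f x0 - (INF y. f y)"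

lemma card_successes:
  assumes n: "enat n \<le> K"
  shows "real (card (successes n)) \<le> (gap / delta + (\<epsilon>0 / L0) powr q) * E"
proof -
  have iK: "enat i < K" if "i < n" for i
    using that n by (meson enat_ord_simps(2) order_less_le_trans)
  \<comment> \<open>Step n - 1 is set apart: for n = K its successor is the returned stationary
    point, where \<open>step_gain\<close> gives nothing. It costs 1 in the count.\<close>
  define S where "S = {i \<in> {..<n - 1}. eta1 P \<le> \<rho> i}"
  have "successes n \<subseteq> insert (n - 1) S"
    by (auto simp: S_def)
  then have "card (successes n) \<le> card (insert (n - 1) S)"
    by (intro card_mono) (auto simp: S_def)
  also have "\<dots> \<le> card S + 1"
    by (simp add: card_insert_if S_def)
  finally have card_le: "real (card (successes n)) \<le> real (card S) + 1" by linarith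
  have "real (card S) * delta = (\<Sum>i\<in>S. delta)" by simp
  also have "\<dots> \<le> (\<Sum>i\<in>S. (f (x i) - f (x (Suc i))) * E)"
  proof (intro sum_mono step_gain)
    fix i assume "i \<in> S"
    then have i: "i < n - 1" "eta1 P \<le> \<rho> i" by (auto simp: S_def)
    then show "enat i < K" "eta1 P \<le> \<rho> i" by (auto intro: iK)
    from i(1) have "Suc i < n" by simp
    from not_stationary[OF iK[OF this]] show "\<epsilon> < grad_norm (x (Suc i))" .
  qed
  \<comment> \<open>Since f never increases along the run, the omitted steps contribute nonnegative
    terms, and the full sum telescopes.\<close>
  also have "\<dots> \<le> (\<Sum>i<n. (f (x i) - f (x (Suc i))) * E)"
    using f_decreasing iK E_pos by (intro sum_mono2) (auto simp: S_def)
  also have "\<dots> = (f x0 - f (x n)) * E"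
    using sum_lessThan_telescope'[of "\<lambda>i. f (x i)" n] by (simp add: run_init sum_distrib_right[symmetric])
  also have "\<dots> \<le> gap * E"
    using E_pos cINF_lower[OF bdd, of "x n"] by (intro mult_right_mono) auto
  finally have "real (card S) \<le> gap / delta * E"
    using delta_pos by (simp add: field_simps)
  with card_le E_ge show ?thesis
    by (simp add: distrib_right)
qed

lemma alpha_product:
  "enat n \<le> K \<Longrightarrow>
     alpha_init P * gamma1 P ^ card (successes n) * gamma2 P ^ card (rejections n) \<le> \<alpha> n"
proof (induction n)
  case 0
  then show ?case by (simp add: run_init)
next
  case (Suc n)
  then have n: "enat n < K" by (simp add: Suc_ile_eq)
  have "(if eta1 P \<le> \<rho> n then gamma1 P else gamma2 P) *
      (alpha_init P * gamma1 P ^ card (successes n) * gamma2 P ^ card (rejections n))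
      \<le> (if eta1 P \<le> \<rho> n then gamma1 P else gamma2 P) * \<alpha> n"
    using Suc.IH n valid by (intro mult_left_mono) auto
  also have "\<dots> \<le> \<alpha> (Suc n)"
    using alpha_growth[OF n] .
  finally have *: "(if eta1 P \<le> \<rho> n then gamma1 P else gamma2 P) *
      (alpha_init P * gamma1 P ^ card (successes n) * gamma2 P ^ card (rejections n)) \<le> \<alpha> (Suc n)" .
  show ?case
  proof (cases "eta1 P \<le> \<rho> n")
    case True
    then have "successes (Suc n) = insert n (successes n)" "rejections (Suc n) = rejections n"
      by (auto simp: less_Suc_eq)
    with * True show ?thesis by (simp add: mult.commute mult.left_commute)
  next
    case False
    then have "rejections (Suc n) = insert n (rejections n)" "successes (Suc n) = successes n"
      by (auto simp: less_Suc_eq)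
    with * False show ?thesis by (simp add: mult.commute mult.left_commute)
  qed
qed

text \<open>Splitting q = 1 + 1/p gives E one factor L/\<epsilon>, which pays for L/\<epsilon>0, and
  a factor (L/\<epsilon>)^(1/p) bounded below by (L0/\<epsilon>0)^(1/p).\<close>

lemma L_le_E: "L \<le> \<epsilon>0 * (\<epsilon>0 / L0) powr (1 / real p) * E"
proof -
  have E: "E = (L / \<epsilon>) * (L / \<epsilon>) powr (1 / real p)"
  proof -
    have "q = 1 + 1 / real p" using p by (simp add: field_simps)
    then show ?thesis using L \<epsilon> by (simp add: powr_add)
  qed
  have "1 powr (1 / real p) \<le> (\<epsilon>0 / L0 * (L / \<epsilon>)) powr (1 / real p)"
    using ratio_bounds L0 \<epsilon>0 \<epsilon> L by (intro powr_mono2) (auto simp: field_simps)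
  also have "\<dots> = (\<epsilon>0 / L0) powr (1 / real p) * (L / \<epsilon>) powr (1 / real p)"
    using L0 \<epsilon>0 \<epsilon> L by (intro powr_mult)
  finally have 1: "1 \<le> (\<epsilon>0 / L0) powr (1 / real p) * (L / \<epsilon>) powr (1 / real p)"
    by simp
  have "L \<le> \<epsilon>0 * (L / \<epsilon>)"
    using \<epsilon> \<epsilon>0 L by (simp add: field_simps)
  then have "L * 1 \<le> \<epsilon>0 * (L / \<epsilon>) * ((\<epsilon>0 / L0) powr (1 / real p) * (L / \<epsilon>) powr (1 / real p))"
    using 1 L \<epsilon> \<epsilon>0 by (intro mult_mono) auto
  then show ?thesis
    unfolding E by (simp only: mult.assoc mult.left_commute mult_1_right)
qed

text \<open>Taking logarithms of the product bound gives a linear relation between the two counts.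
  The crude estimate ln (max 1 z) \<le> z is affordable because z is proportional to L, hence at
  most a multiple of E.\<close>

lemma card_rejections:
  assumes n: "enat n \<le> K"
  shows "real (card (rejections n)) * ln (gamma2 P) \<le>
      real (card (successes n)) * ln (1 / gamma1 P) +
      gamma3 P / ((1 - eta2 P) * alpha_init P) * \<epsilon>0 * (\<epsilon>0 / L0) powr (1 / real p) * E"
proof -
  define s u where "s = card (successes n)" and "u = card (rejections n)"
  define z where "z = gamma3 P / ((1 - eta2 P) * alpha_init P) * L"
  have z: "0 < z" using valid L by (simp add: z_def)
  have "alpha_init P * (gamma1 P ^ s * gamma2 P ^ u) \<le> max (alpha_init P) (gamma3 P * L / (1 - eta2 P))"
    using alpha_product[OF n] alpha_le[OF n] by (simp add: s_def u_def mult.assoc)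
  also have "\<dots> = alpha_init P * max 1 z"
    using valid by (simp add: max_mult_distrib_left z_def)
  finally have "gamma1 P ^ s * gamma2 P ^ u \<le> max 1 z"
    using valid(4) by simp
  then have "ln (gamma1 P ^ s * gamma2 P ^ u) \<le> ln (max 1 z)"
    using valid by (intro ln_mono) auto
  also have "\<dots> \<le> z"
    using z ln_le_minus_one[of z] by (auto simp: max_def)
  also have "z \<le> gamma3 P / ((1 - eta2 P) * alpha_init P) * (\<epsilon>0 * (\<epsilon>0 / L0) powr (1 / real p) * E)"
    unfolding z_def using valid L_le_E by (intro mult_left_mono) auto
  finally show ?thesis
    using valid by (simp add: ln_mult ln_realpow ln_div s_def u_def mult.assoc algebra_simps)
qed

lemma length_oracle_calls: "length (oracle_calls p R x v n) = n * (p + 2) + (p + 1)"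
  by (simp add: oracle_calls_def length_concat o_def sum_list_triv)

lemma iteration_bound:
  assumes n: "enat n \<le> K"
  shows "real (Suc n + length (oracle_calls p R x v n)) \<le> rar_const p P r b gap L0 \<epsilon>0 * E"
proof -
  define N where "N = gap / delta + (\<epsilon>0 / L0) powr q"
  define B where "B = gamma3 P / ((1 - eta2 P) * alpha_init P) * \<epsilon>0 * (\<epsilon>0 / L0) powr (1 / real p)"
  define s u where "s = real (card (successes n))" and "u = real (card (rejections n))"
  define l1 l2 where "l1 = ln (1 / gamma1 P)" and "l2 = ln (gamma2 P)"
  have l: "0 < l1" "0 < l2" using valid by (auto simp: l1_def l2_def)
  have "card (successes n \<union> rejections n) = card (successes n) + card (rejections n)"
    by (intro card_Un_disjoint) auto
  moreover have "successes n \<union> rejections n = {..<n}" by auto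
  ultimately have nsu: "real n = s + u" by (simp add: s_def u_def)
  have s: "s \<le> N * E"
    using card_successes[OF n] by (simp add: s_def N_def)
  have "u * l2 \<le> s * l1 + B * E"
    using card_rejections[OF n] by (simp add: s_def u_def B_def l1_def l2_def)
  also have "\<dots> \<le> N * E * l1 + B * E"
    using s l by (intro add_right_mono mult_right_mono) auto
  finally have "u \<le> (N * l1 / l2 + B / l2) * E"
    using l by (simp add: field_simps)
  with s nsu have "real n + 1 \<le> (N * (1 + l1 / l2) + B / l2 + (\<epsilon>0 / L0) powr q) * E"
    using E_ge by (simp add: algebra_simps)
  \<comment> \<open>Iterations and oracle calls add up to (p+3) n + (p+2), hence at most
    (p+3)(n+1).\<close>
  then have "real (p + 3) * (real n + 1)
      \<le> real (p + 3) * ((N * (1 + l1 / l2) + B / l2 + (\<epsilon>0 / L0) powr q) * E)"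
    by (intro mult_left_mono) auto
  also have "\<dots> = rar_const p P r b gap L0 \<epsilon>0 * E"
    by (simp add: rar_const_def Let_def N_def B_def l1_def l2_def delta_def kappa_def mult.assoc)
  finally show ?thesis
    by (simp add: length_oracle_calls algebra_simps)
qed

text \<open>For an infinite run \<open>iteration_bound\<close> would hold for all n with a fixed
  right-hand side.\<close>

lemma terminates: "\<exists>n. K = enat n"
proof (cases K)
  case infinity
  obtain n :: nat where "rar_const p P r b gap L0 \<epsilon>0 * E < real n"
    using reals_Archimedean2 by blast
  with iteration_bound[of n] infinity show ?thesis by simp
qed auto

lemma stationary_at_end: "K = enat n \<Longrightarrow> grad_norm (x n) \<le> \<epsilon>"
  using run by (auto simp: rar_run_def)

end

theorem theorem3p4:
  fixes A :: "('m::{t2_space,second_countable_topology}, 'e::euclidean_space) chart set"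
    and g :: "'m \<Rightarrow> 'e \<Rightarrow> 'e \<Rightarrow> real"
    and R :: "'m \<Rightarrow> 'e \<Rightarrow> 'm"
    and VT :: "'m \<Rightarrow> 'e \<Rightarrow> 'e \<Rightarrow> 'e"
    and f :: "'m \<Rightarrow> real"
    and p :: nat
    and P :: rar_params
    and x0 :: 'm
    and x :: "nat \<Rightarrow> 'm"
    and \<alpha> :: "nat \<Rightarrow> real"
    and v :: "nat \<Rightarrow> 'e"
    and K :: enat
    and L r b \<epsilon>\<^sub>1 L0 \<epsilon>0 :: real
  assumes "1 \<le> p"
    and "smooth_atlas A"
    and "riemannian_metric A g"
    and "manifold_retraction A R"
    and "vector_transport A R VT"
    and "Ck_fun p A f"
    and "bdd_below (range f)"
    and "valid_params P"
    and "0 < L" and "0 < r" and "0 < b"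
    and "0 < L0" and "L0 \<le> L"
    and "0 < \<epsilon>\<^sub>1" and "0 < \<epsilon>0" and "\<epsilon>\<^sub>1 \<le> \<epsilon>0"
    and "rar_run p P \<epsilon>\<^sub>1 A g R f x0 x \<alpha> v K"
    and "majorization_smooth L p g R f (rar_increments x v K)"
    and "transport_smooth L p g R VT f (rar_increments x v K)"
    and "short_step_lower_bound r b g R VT (rar_increments x v K)"
  shows "\<exists>n. K = enat n \<and>
           rnorm g (x n) (rgrad A g f (x n)) \<le> \<epsilon>\<^sub>1 \<and>
           real (Suc n + length (oracle_calls p R x v n))
             \<le> rar_const p P r b (f x0 - (INF y. f y)) L0 \<epsilon>0
                * (L / \<epsilon>\<^sub>1) powr (real (p + 1) / real p)"
proof -
  interpret rar_iteration A g R VT f p P x0 x \<alpha> v K L r b \<epsilon>\<^sub>1 L0 \<epsilon>0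
    using assms by unfold_locales
  obtain n where "K = enat n"
    using terminates by blast
  then show ?thesis
    using stationary_at_end iteration_bound[of n] by auto
qed

end
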